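(* Let $X\subseteq\omega$ be a slow coinfinite primitive recursive set and let $Y\subseteq\omega$ be a coinfinite primitive recursive set such that the pair $(Y,2\omega)$ satisfies the black-lozenge property, where $2\omega$ is the set of even numbers. Then no automorphism of $(\mathbf{Peq},\leq)$ maps $\deg(R_Y)$ to $\deg(R_X)$. Moreover, the uppercones of $\mathbf{Peq}$ are not always isomorphic to each other: there are degrees $\mathbf{a},\mathbf{b}\in\mathbf{Peq}$ such that the posets $\{\mathbf{d}\in\mathbf{Peq}:\mathbf{d}\geq\mathbf{a}\}$ and $\{\mathbf{d}\in\mathbf{Peq}:\mathbf{d}\geq\mathbf{b}\}$ are not isomorphic.
   Context: A punctual equivalence relation is a primitive recursive equivalence relation with domain $\omega$ having infinitely many equivalence classes. For equivalence relations $R,S$ on $\omega$, $R\leq_{pr} S$ means that there is a primitive recursive function $f:\omega\to\omega$ such that for all $x,y\in\omega$, $x\mathrel{R}y \Leftrightarrow f(x)\mathrel{S}f(y)$. Write $R\equiv_{pr}S$ if $R\leq_{pr}S$ and $S\leq_{pr}R$. $(\mathbf{Peq},\leq)$ is the partial order of $\equiv_{pr}$-classes $\deg(R)$ of punctual equivalence relations $R$, ordered by the order induced by $\leq_{pr}$. For $X\subseteq\omega$, $R_X$ is given by $x\mathrel{R_X}y \Leftrightarrow (x,y\in X \text{ or } x=y)$. For coinfinite $X$, $p_{\overline{X}}(n)$ denotes the $n$-th element of the complement $\overline{X}$ in increasing order. A coinfinite primitive recursive set $X$ is slow if for every primitive recursive function $r$, $p_{\overline{X}}(n+1)>r(p_{\overline{X}}(n))$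 holds for all but finitely many $n$. For a set $U$ let $\#(0^U)[s]$ be the number of $i\leq s$ with $i\notin U$. A pair $(X,Y)$ of coinfinite primitive recursive sets satisfies the black-lozenge property if there are (infinite and coinfinite) primitive recursive sets $X^*,Y^*$ with $R_{X^*}\equiv_{pr}R_X$, $R_{Y^*}\equiv_{pr}R_Y$ and $(\forall s)(\exists t\geq s)\,[\#(0^{X^*})[t]=\#(0^{Y^*})[t]]$. *)

theory Defs
  imports "HOL-Library.Infinite_Set"
begin

text \<open>
  An \<open>n\<close>-ary function is represented on argument lists; only its values on lists of length \<open>n\<close>
  matter.  In the recursion scheme the recursion argument is the head of the list:
  \<open>f(0, xs) = g(xs)\<close> and \<open>f(k + 1, xs) = h(k, f(k, xs), xs)\<close>.
\<close>

inductive primrec_fun :: "nat \<Rightarrow> (nat list \<Rightarrow> nat) \<Rightarrow> bool" where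
  zero: "primrec_fun n (\<lambda>xs. 0)"
| succ: "primrec_fun 1 (\<lambda>xs. Suc (xs ! 0))"
| proj: "i < n \<Longrightarrow> primrec_fun n (\<lambda>xs. xs ! i)"
| comp: "primrec_fun (length hs) g \<Longrightarrow> (\<forall>h\<in>set hs. primrec_fun n h) \<Longrightarrow>
    primrec_fun n (\<lambda>xs. g (map (\<lambda>h. h xs) hs))"
| prec: "primrec_fun n g \<Longrightarrow> primrec_fun (Suc (Suc n)) h \<Longrightarrow>
    primrec_fun (Suc n) (\<lambda>xs. rec_nat (g (tl xs)) (\<lambda>k r. h (k # r # tl xs)) (hd xs))"

definition primrec_unary :: "(nat \<Rightarrow> nat) \<Rightarrow> bool" where
  "primrec_unary f \<longleftrightarrow> (\<exists>g. primrec_fun 1 g \<and> (\<forall>x. g [x] = f x))"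

definition primrec_set :: "nat set \<Rightarrow> bool" where
  "primrec_set X \<longleftrightarrow> (\<exists>g. primrec_fun 1 g \<and> (\<forall>x. g [x] = of_bool (x \<in> X)))"

definition primrec_rel :: "nat rel \<Rightarrow> bool" where
  "primrec_rel R \<longleftrightarrow> (\<exists>g. primrec_fun 2 g \<and> (\<forall>x y. g [x, y] = of_bool ((x, y) \<in> R)))"

definition punctual_equiv :: "nat rel \<Rightarrow> bool" where
  "punctual_equiv R \<longleftrightarrow> equiv UNIV R \<and> primrec_rel R \<and> infinite (UNIV // R)"

definition pr_le :: "nat rel \<Rightarrow> nat rel \<Rightarrow> bool"  (infix "\<le>pr" 50) where
  "R \<le>pr S \<longleftrightarrow> (\<exists>f. primrec_unary f \<and> (\<forall>x y. (x, y) \<in> R \<longleftrightarrow> (f x, f y) \<in> S))"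

definition pr_eq :: "nat rel \<Rightarrow> nat rel \<Rightarrow> bool"  (infix "\<equiv>pr" 50) where
  "R \<equiv>pr S \<longleftrightarrow> R \<le>pr S \<and> S \<le>pr R"

definition pr_eq_rel :: "nat rel rel" where
  "pr_eq_rel = {(R, S). punctual_equiv R \<and> punctual_equiv S \<and> R \<equiv>pr S}"

definition Peq :: "nat rel set set" where
  "Peq = {R. punctual_equiv R} // pr_eq_rel"

definition pr_deg :: "nat rel \<Rightarrow> nat rel set" where
  "pr_deg R = pr_eq_rel `` {R}"

definition deg_le :: "nat rel set \<Rightarrow> nat rel set \<Rightarrow> bool" where
  "deg_le a b \<longleftrightarrow> (\<exists>R\<in>a. \<exists>S\<in>b. R \<le>pr S)"

definition upper_cone :: "nat rel set \<Rightarrow> nat rel set set" where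
  "upper_cone a = {d \<in> Peq. deg_le a d}"

definition deg_iso :: "nat rel set set \<Rightarrow> nat rel set set \<Rightarrow> (nat rel set \<Rightarrow> nat rel set) \<Rightarrow> bool" where
  "deg_iso A B \<phi> \<longleftrightarrow>
     bij_betw \<phi> A B \<and> (\<forall>a\<in>A. \<forall>b\<in>A. deg_le a b \<longleftrightarrow> deg_le (\<phi> a) (\<phi> b))"

definition set_rel :: "nat set \<Rightarrow> nat rel" where
  "set_rel X = {(x, y). (x \<in> X \<and> y \<in> X) \<or> x = y}"

text \<open>Primitive recursiveness and coinfiniteness are not part of the next definition.\<close>

definition slow :: "nat set \<Rightarrow> bool" where
  "slow X \<longleftrightarrow> (\<forall>r. primrec_unary r \<longrightarrow>
     (\<forall>\<^sub>\<infinity>n. enumerate (- X) (Suc n) > r (enumerate (- X) n)))"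

definition count_zeros :: "nat set \<Rightarrow> nat \<Rightarrow> nat" where
  "count_zeros U s = card {i. i \<le> s \<and> i \<notin> U}"

text \<open>Primitive recursiveness and coinfiniteness are required here of the witnesses only, not of
  \<open>X\<close> and \<open>Y\<close> themselves.\<close>

definition black_lozenge :: "nat set \<Rightarrow> nat set \<Rightarrow> bool" where
  "black_lozenge X Y \<longleftrightarrow> (\<exists>X' Y'.
     primrec_set X' \<and> infinite X' \<and> infinite (- X') \<and>
     primrec_set Y' \<and> infinite Y' \<and> infinite (- Y') \<and>
     set_rel X' \<equiv>pr set_rel X \<and> set_rel Y' \<equiv>pr set_rel Y \<and>
     (\<forall>s. \<exists>t\<ge>s. count_zeros X' t = count_zeros Y' t))"

lemma primrec_unary_id: "primrec_unary (\<lambda>x. x)"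
  unfolding primrec_unary_def by (rule exI[of _ "\<lambda>xs. xs ! 0"]) (auto intro: primrec_fun.proj)

lemma primrec_unary_comp:
  assumes "primrec_unary f" "primrec_unary g"
  shows "primrec_unary (\<lambda>x. g (f x))"
proof -
  obtain F G where F: "primrec_fun 1 F" "\<And>x. F [x] = f x" and G: "primrec_fun 1 G" "\<And>x. G [x] = g x"
    using assms unfolding primrec_unary_def by blast
  have "primrec_fun 1 (\<lambda>xs. G (map (\<lambda>h. h xs) [F]))"
    using F G by (intro primrec_fun.comp) auto
  then show ?thesis
    unfolding primrec_unary_def
    by (intro exI[of _ "\<lambda>xs. G (map (\<lambda>h. h xs) [F])"]) (auto simp: F G)
qed

lemma pr_le_refl: "R \<le>pr R"
  unfolding pr_le_def using primrec_unary_id by blast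

lemma pr_le_trans: "R \<le>pr S \<Longrightarrow> S \<le>pr T \<Longrightarrow> R \<le>pr T"
  unfolding pr_le_def by (metis primrec_unary_comp)

lemma equiv_pr_eq_rel: "equiv {R. punctual_equiv R} pr_eq_rel"
  by (intro equivI refl_onI symI transI)
    (auto simp: pr_eq_rel_def pr_eq_def pr_le_refl intro: pr_le_trans)

lemma deg_le_pr_deg:
  assumes "punctual_equiv R" "punctual_equiv S"
  shows "deg_le (pr_deg R) (pr_deg S) \<longleftrightarrow> R \<le>pr S"
  using assms unfolding deg_le_def pr_deg_def pr_eq_rel_def pr_eq_def
  by (auto intro: pr_le_refl pr_le_trans)

lemma primrec_fun_subst1:
  assumes "primrec_fun 1 g" "primrec_fun n h"
  shows "primrec_fun n (\<lambda>xs. g [h xs])"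
  using primrec_fun.comp[of "[h]" g n] assms by simp

lemma primrec_fun_subst2:
  assumes "primrec_fun 2 g" "primrec_fun n h" "primrec_fun n k"
  shows "primrec_fun n (\<lambda>xs. g [h xs, k xs])"
  using primrec_fun.comp[of "[h, k]" g n] assms by (simp add: numeral_2_eq_2)

lemma primrec_fun_subst3:
  assumes "primrec_fun 3 g" "primrec_fun n h" "primrec_fun n k" "primrec_fun n l"
  shows "primrec_fun n (\<lambda>xs. g [h xs, k xs, l xs])"
  using primrec_fun.comp[of "[h, k, l]" g n] assms by (simp add: numeral_3_eq_3)

lemma primrec_fun_if:
  "\<exists>g. primrec_fun 3 g \<and> (\<forall>x y z. g [x, y, z] = (if x = 0 then z else y))"
proof -
  have "primrec_fun (Suc 2) (\<lambda>xs. rec_nat ((\<lambda>xs. xs ! 1) (tl xs))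
      (\<lambda>k r. (\<lambda>xs. xs ! 2) (k # r # tl xs)) (hd xs))"
    by (intro primrec_fun.prec primrec_fun.proj) auto
  moreover have "rec_nat z (\<lambda>k r. y) x = (if x = 0 then z else y)" for x y z :: nat
    by (cases x) auto
  ultimately show ?thesis
    by (intro exI conjI) (auto simp: numeral_3_eq_3 numeral_2_eq_2)
qed

lemma primrec_fun_pred: "\<exists>g. primrec_fun 1 g \<and> (\<forall>x. g [x] = x - 1)"
proof -
  have "primrec_fun (Suc 0) (\<lambda>xs. rec_nat ((\<lambda>xs. 0) (tl xs))
      (\<lambda>k r. (\<lambda>xs. xs ! 0) (k # r # tl xs)) (hd xs))"
    by (intro primrec_fun.prec primrec_fun.proj primrec_fun.zero) auto
  moreover have "rec_nat 0 (\<lambda>k r. k) x = x - 1" for x :: nat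
    by (cases x) auto
  ultimately show ?thesis
    by (intro exI conjI) auto
qed

text \<open>Truncated subtraction with the arguments swapped, \<open>(x, y) \<mapsto> y - x\<close>.\<close>

lemma primrec_fun_minus: "\<exists>g. primrec_fun 2 g \<and> (\<forall>x y. g [x, y] = y - x)"
proof -
  obtain p where p: "primrec_fun 1 p" "\<And>x. p [x] = x - 1"
    using primrec_fun_pred by blast
  have "primrec_fun (Suc 1) (\<lambda>xs. rec_nat ((\<lambda>xs. xs ! 0) (tl xs))
      (\<lambda>k r. (\<lambda>xs. p [xs ! 1]) (k # r # tl xs)) (hd xs))"
    by (intro primrec_fun.prec primrec_fun.proj primrec_fun_subst1 p) auto
  moreover have "rec_nat y (\<lambda>k r. p [r]) x = y - x" for x y :: nat
    by (induction x) (auto simp: p)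
  ultimately show ?thesis
    by (intro exI conjI) (auto simp: numeral_2_eq_2)
qed

lemma punctual_equiv_set_rel:
  assumes "primrec_set X" "infinite (- X)"
  shows "punctual_equiv (set_rel X)"
proof -
  obtain c where c: "primrec_fun 1 c" "\<And>x. c [x] = of_bool (x \<in> X)"
    using assms unfolding primrec_set_def by blast
  obtain i where i: "primrec_fun 3 i" "\<And>x y z. i [x, y, z] = (if x = 0 then z else y)"
    using primrec_fun_if by blast
  obtain d where d: "primrec_fun 2 d" "\<And>x y. d [x, y] = y - x"
    using primrec_fun_minus by blast
  define one :: "nat list \<Rightarrow> nat" where "one = (\<lambda>xs. Suc ([0] ! 0))"
  have one: "primrec_fun 2 one"
    using primrec_fun_subst1[OF primrec_fun.succ primrec_fun.zero] by (simp add: one_def)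
  have one1: "one xs = 1" for xs
    by (simp add: one_def)
  have zero: "primrec_fun 2 (\<lambda>xs. 0)"
    by (rule primrec_fun.zero)
  have x: "primrec_fun 2 (\<lambda>xs. xs ! 0)" and y: "primrec_fun 2 (\<lambda>xs. xs ! 1)"
    by (simp_all add: primrec_fun.proj)
  define eq where
    "eq = (\<lambda>xs. i [d [xs ! 0, xs ! 1], 0, i [d [xs ! 1, xs ! 0], 0, one xs]])"
  have eq: "primrec_fun 2 eq"
    unfolding eq_def
    using primrec_fun_subst3[OF i(1) primrec_fun_subst2[OF d(1) x y] zero
      primrec_fun_subst3[OF i(1) primrec_fun_subst2[OF d(1) y x] zero one]] .
  have eq1: "eq [x, y] = of_bool (x = y)" for x y
    by (simp add: eq_def i d one1)
  define g where "g = (\<lambda>xs. i [c [xs ! 0], i [c [xs ! 1], one xs, eq xs], eq xs])"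
  have "primrec_fun 2 g"
    unfolding g_def
    using primrec_fun_subst3[OF i(1) primrec_fun_subst1[OF c(1) x]
      primrec_fun_subst3[OF i(1) primrec_fun_subst1[OF c(1) y] one eq] eq] .
  moreover have "g [x, y] = of_bool ((x, y) \<in> set_rel X)" for x y
    by (simp add: g_def c i one1 eq1 set_rel_def)
  ultimately have pr: "primrec_rel (set_rel X)"
    unfolding primrec_rel_def by blast
  have equiv: "equiv UNIV (set_rel X)"
    by (intro equivI refl_onI symI transI) (auto simp: set_rel_def)
  have cls: "set_rel X `` {x} = {x}" if "x \<in> - X" for x
    using that by (auto simp: set_rel_def)
  have "infinite ((\<lambda>x. {x}) ` (- X))"
    using assms(2) by (simp add: finite_image_iff)
  moreover have "(\<lambda>x. {x}) ` (- X) \<subseteq> UNIV // set_rel X"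
    using cls by (auto simp: quotient_def)
  ultimately have "infinite (UNIV // set_rel X)"
    using infinite_super by blast
  with pr equiv show ?thesis
    unfolding punctual_equiv_def by blast
qed

end

theory Submission
  imports Defs "HOL-Library.Nat_Bijection"
begin

text \<open>
  A punctual equivalence relation \<open>R\<close> enters its degree only through the growth of the number of
  \<open>R\<close>-classes that meet \<open>{..<s}\<close>: \<open>R \<le>pr S\<close> holds iff, for some primitive recursive \<open>h\<close>, the count of
  \<open>R\<close> at every \<open>s\<close> is at most the count of \<open>S\<close> at \<open>h s\<close> (\<open>pr_le_iff_speed_le\<close>).  The degrees are
  therefore the counting functions (primitive recursive, unbounded, growing by at most one at a
  time) up to primitive recursive speed-up.  Pointwise maximum and minimum give joins and meets,
  and the identity is the greatest element.

  The order property that tells the two degrees apart: a degree \<open>a\<close> \<^emph>\<open>splits\<close> if it is the meet of two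
  degrees \<open>b, c\<close> that are not greatest but have the greatest degree as their join.

  If \<open>X\<close> is slow and \<open>u\<close> counts the classes of \<open>R\<^sub>X\<close>, then \<open>u (h s) < s\<close> for all large \<open>s\<close>, for every
  primitive recursive \<open>h\<close> (\<open>slow_dominates\<close>).  Suppose that \<open>max b c\<close> reaches \<open>s\<close> by stage \<open>h s\<close> for
  every \<open>s\<close>.  If \<open>b\<close> does this for \<open>s\<close> and \<open>c\<close> for \<open>s + 1\<close>, then both are at least \<open>s\<close> at stage
  \<open>h (s + 1)\<close>, hence so is their meet \<open>u\<close> after a further primitive recursive delay, which is
  impossible for large \<open>s\<close>.  So \<open>b\<close> and \<open>c\<close> cannot hand the work over to each other, one of them does
  it alone from some point on, and that one is greatest (\<open>no_split_if_dominated\<close>).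

  If \<open>Y\<close> has the black-lozenge property with the even numbers, a counting function \<open>y\<close> for its degree
  agrees infinitely often with a greatest one \<open>e\<close>, and at such stages a function that follows \<open>y\<close> may
  change over to \<open>e\<close> or back without a jump.  Of two functions \<open>b, c\<close>, let one follow \<open>y\<close> and the other
  \<open>e\<close>.  Unless \<open>y\<close> is itself greatest, the follower of \<open>y\<close> eventually falls behind the \<open>j\<close>-th bound of
  a sequence of bounds; at the next agreement the roles are exchanged and the next bound is treated.
  Then \<open>min b c = y\<close> and \<open>max b c \<ge> e\<close>, while neither \<open>b\<close> nor \<open>c\<close> is greatest (\<open>split_exists\<close>).  The
  sequence has to majorize all primitive recursive functions although the construction is primitive
  recursive: a fast-growing hierarchy serves, because its graph is primitive recursive uniformly in
  the level (\<open>fast_graph\<close>).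

  For the upper cones, the cone of the greatest degree is a single point, and the same diagonal
  construction yields a degree that is not greatest (\<open>exists_not_top\<close>).
\<close>

section \<open>Closure properties of primitive recursive functions\<close>

text \<open>
  Agreement is required on lists of length \<open>n\<close> only, which makes the notion insensitive to the values
  that the generating functions happen to take on other lists.
\<close>

definition pr :: "nat \<Rightarrow> (nat list \<Rightarrow> nat) \<Rightarrow> bool" where
  "pr n f \<longleftrightarrow> (\<exists>g. primrec_fun n g \<and> (\<forall>xs. length xs = n \<longrightarrow> g xs = f xs))"

abbreviation prp :: "nat \<Rightarrow> (nat list \<Rightarrow> bool) \<Rightarrow> bool" where
  "prp n P \<equiv> pr n (\<lambda>xs. of_bool (P xs))"

lemma pr_cong: "pr n f \<Longrightarrow> (\<And>xs. length xs = n \<Longrightarrow> f xs = g xs) \<Longrightarrow> pr n g"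
  unfolding pr_def by metis

lemma pr_compose:
  assumes "pr (length hs) g" "\<And>h. h \<in> set hs \<Longrightarrow> pr n h"
  shows "pr n (\<lambda>xs. g (map (\<lambda>h. h xs) hs))"
proof -
  obtain g' where g': "primrec_fun (length hs) g'" "\<And>xs. length xs = length hs \<Longrightarrow> g' xs = g xs"
    using assms(1) unfolding pr_def by blast
  have "\<forall>h\<in>set hs. \<exists>h'. primrec_fun n h' \<and> (\<forall>xs. length xs = n \<longrightarrow> h' xs = h xs)"
    using assms(2) unfolding pr_def by blast
  then obtain c where c: "\<And>h. h \<in> set hs \<Longrightarrow> primrec_fun n (c h)"
      "\<And>h xs. h \<in> set hs \<Longrightarrow> length xs = n \<Longrightarrow> c h xs = h xs"
    by metis
  have "primrec_fun n (\<lambda>xs. g' (map (\<lambda>h. h xs) (map c hs)))"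
    using g'(1) c(1) by (intro primrec_fun.comp) auto
  moreover have "g' (map (\<lambda>h. h xs) (map c hs)) = g (map (\<lambda>h. h xs) hs)" if "length xs = n" for xs
  proof -
    have "map (\<lambda>h. h xs) (map c hs) = map (\<lambda>h. h xs) hs"
      using c(2) that by simp
    then show ?thesis
      using g'(2)[of "map (\<lambda>h. h xs) hs"] by (simp only: length_map)
  qed
  ultimately show ?thesis
    unfolding pr_def by blast
qed

lemma pr_nth: "i < n \<Longrightarrow> pr n (\<lambda>xs. xs ! i)"
  unfolding pr_def using primrec_fun.proj by blast

lemma pr_nth_tl:
  assumes "Suc i < n" shows "pr n (\<lambda>xs. tl xs ! i)"
  using assms by (intro pr_cong[OF pr_nth[OF assms]]) (simp add: nth_tl)

lemma pr_nth_tl_tl: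
  assumes "Suc (Suc i) < n" shows "pr n (\<lambda>xs. tl (tl xs) ! i)"
  using assms by (intro pr_cong[OF pr_nth[OF assms]]) (simp add: nth_tl)

lemma pr_Cons:
  assumes "pr (Suc n) f" "pr n g"
  shows "pr n (\<lambda>xs. f (g xs # xs))"
proof -
  let ?hs = "g # map (\<lambda>i xs. xs ! i) [0..<n]"
  have "pr n (\<lambda>xs. f (map (\<lambda>h. h xs) ?hs))"
    using assms by (intro pr_compose) (auto intro: pr_nth)
  then show ?thesis
    by (rule pr_cong) (simp add: comp_def, metis map_nth)
qed

lemma pr_tl:
  assumes "pr n f" shows "pr (Suc n) (\<lambda>xs. f (tl xs))"
proof -
  have "pr (Suc n) (\<lambda>xs. f (map (\<lambda>h. h xs) (map (\<lambda>i xs. xs ! Suc i) [0..<n])))"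
    using assms by (intro pr_compose) (auto intro: pr_nth)
  then show ?thesis
    by (rule pr_cong) (auto intro!: arg_cong[of _ _ f] nth_equalityI simp: nth_tl)
qed

text \<open>
  In a recursion, the list in front of the parameters holds the index and the previous value; a
  summand depends on the index and the parameters alone.
\<close>

lemma pr_skip:
  assumes "pr (Suc n) (\<lambda>ys. f (ys ! 0) (tl ys))"
  shows "pr (Suc (Suc n)) (\<lambda>ys. f (ys ! 0) (tl (tl ys)))"
proof -
  let ?hs = "(\<lambda>ys. ys ! 0) # map (\<lambda>i ys. ys ! Suc (Suc i)) [0..<n]"
  have "pr (Suc (Suc n)) (\<lambda>ys. (\<lambda>ys. f (ys ! 0) (tl ys)) (map (\<lambda>h. h ys) ?hs))"
    using assms by (intro pr_compose) (auto intro: pr_nth)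
  then show ?thesis
    by (rule pr_cong) (auto intro!: arg_cong[of _ _ "f _"] nth_equalityI simp: nth_tl)
qed

lemma pr_Suc:
  assumes "pr n f" shows "pr n (\<lambda>xs. Suc (f xs))"
proof -
  have "pr 1 (\<lambda>xs. Suc (xs ! 0))"
    unfolding pr_def using primrec_fun.succ by blast
  then show ?thesis
    using pr_compose[of "[f]" "\<lambda>xs. Suc (xs ! 0)" n] assms by simp
qed

lemma pr_0: "pr n (\<lambda>xs. 0)"
  unfolding pr_def using primrec_fun.zero by blast

lemma pr_const: "pr n (\<lambda>xs. c)"
  by (induction c) (auto intro: pr_Suc pr_0)

text \<open>
  A body with bound variables becomes a function of the longer list that has these variables in
  front, so that closure proofs can proceed by introduction rules.
\<close>

lemma pr_rec:
  assumes g: "pr n g" and h: "pr (Suc (Suc n)) (\<lambda>ys. h (ys ! 0) (ys ! 1) (tl (tl ys)))" and m: "pr n m"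
  shows "pr n (\<lambda>xs. rec_nat (g xs) (\<lambda>k r. h k r xs) (m xs))"
proof -
  obtain g' where g': "primrec_fun n g'" "\<And>xs. length xs = n \<Longrightarrow> g' xs = g xs"
    using g unfolding pr_def by blast
  obtain h' where h': "primrec_fun (Suc (Suc n)) h'"
      "\<And>xs. length xs = Suc (Suc n) \<Longrightarrow> h' xs = h (xs ! 0) (xs ! 1) (tl (tl xs))"
    using h unfolding pr_def by blast
  let ?F = "\<lambda>xs. rec_nat (g' (tl xs)) (\<lambda>k r. h' (k # r # tl xs)) (hd xs)"
  have "pr (Suc n) ?F"
    unfolding pr_def using primrec_fun.prec[OF g'(1) h'(1)] by blast
  from pr_Cons[OF this m] show ?thesis
    by (rule pr_cong) (simp add: g'(2) h'(2))
qed

lemma pr_add: "pr n f \<Longrightarrow> pr n g \<Longrightarrow> pr n (\<lambda>xs. f xs + g xs)"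
proof -
  assume a: "pr n f" "pr n g"
  have "pr n (\<lambda>xs. rec_nat (g xs) (\<lambda>k r. Suc r) (f xs))"
    by (intro pr_rec pr_Suc pr_nth a) auto
  moreover have "rec_nat y (\<lambda>k r. Suc r) x = x + y" for x y :: nat
    by (induction x) auto
  ultimately show ?thesis by simp
qed

lemma pr_diff: "pr n f \<Longrightarrow> pr n g \<Longrightarrow> pr n (\<lambda>xs. f xs - g xs)"
proof -
  assume a: "pr n f" "pr n g"
  have pred: "pr m (\<lambda>xs. h xs - 1)" if "pr m h" for m h
  proof -
    have "pr m (\<lambda>xs. rec_nat 0 (\<lambda>k r. k) (h xs))"
      by (intro pr_rec pr_nth pr_0 that) auto
    moreover have "rec_nat 0 (\<lambda>k r. k) x = x - 1" for x :: nat
      by (cases x) auto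
    ultimately show ?thesis by simp
  qed
  have "pr n (\<lambda>xs. rec_nat (f xs) (\<lambda>k r. r - 1) (g xs))"
    by (intro pr_rec pred pr_nth a) auto
  moreover have "rec_nat x (\<lambda>k r. r - 1) y = x - y" for x y :: nat
    by (induction y) auto
  ultimately show ?thesis by simp
qed

lemma pr_mult: "pr n f \<Longrightarrow> pr n g \<Longrightarrow> pr n (\<lambda>xs. f xs * g xs)"
proof -
  assume a: "pr n f" "pr n g"
  have "pr n (\<lambda>xs. rec_nat 0 (\<lambda>k r. r + g xs) (f xs))"
    by (intro pr_rec pr_add pr_tl[of "Suc n" "\<lambda>ys. g (tl ys)"] pr_tl[of n g] pr_nth pr_0 a) auto
  moreover have "rec_nat 0 (\<lambda>k r. r + y) x = x * y" for x y :: nat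
    by (induction x) auto
  ultimately show ?thesis by simp
qed

lemma prp_not: "prp n P \<Longrightarrow> prp n (\<lambda>xs. \<not> P xs)"
  using pr_diff[OF pr_const[of n 1], of "\<lambda>xs. of_bool (P xs)"]
  by (rule pr_cong) auto

lemma prp_conj: "prp n P \<Longrightarrow> prp n Q \<Longrightarrow> prp n (\<lambda>xs. P xs \<and> Q xs)"
  by (rule pr_cong[OF pr_mult[of n "\<lambda>xs. of_bool (P xs)" "\<lambda>xs. of_bool (Q xs)"]]) auto

lemma prp_disj: "prp n P \<Longrightarrow> prp n Q \<Longrightarrow> prp n (\<lambda>xs. P xs \<or> Q xs)"
  using prp_not[OF prp_conj[OF prp_not prp_not], of n P Q] by simp

lemma pr_if:
  assumes "prp n P" "pr n f" "pr n g"
  shows "pr n (\<lambda>xs. if P xs then f xs else g xs)"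
proof -
  have "pr n (\<lambda>xs. of_bool (P xs) * f xs + of_bool (\<not> P xs) * g xs)"
    using assms by (intro pr_add pr_mult prp_not)
  then show ?thesis
    by (rule pr_cong) auto
qed

lemma prp_pos: "pr n f \<Longrightarrow> prp n (\<lambda>xs. 0 < f xs)"
  using pr_diff[OF pr_const[of n 1] pr_diff[OF pr_const[of n 1], of f]]
  by (rule pr_cong) auto

lemma prp_less: "pr n f \<Longrightarrow> pr n g \<Longrightarrow> prp n (\<lambda>xs. f xs < g xs)"
  using prp_pos[OF pr_diff, of n g f] by simp

lemma prp_le: "pr n f \<Longrightarrow> pr n g \<Longrightarrow> prp n (\<lambda>xs. f xs \<le> g xs)"
  using prp_not[OF prp_less, of n g f] by (simp add: not_less)

lemma prp_eq: "pr n f \<Longrightarrow> pr n g \<Longrightarrow> prp n (\<lambda>xs. f xs = g xs)"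
  using prp_conj[OF prp_le prp_le, of n f g g f] by (simp add: eq_iff)

lemma pr_app1:
  assumes "primrec_unary f" "pr n g" shows "pr n (\<lambda>xs. f (g xs))"
proof -
  have "pr 1 (\<lambda>xs. f (xs ! 0))"
    using assms(1) unfolding primrec_unary_def pr_def by (auto simp: length_Suc_conv)
  then show ?thesis
    using pr_compose[of "[g]" "\<lambda>xs. f (xs ! 0)" n] assms(2) by simp
qed

lemma pr_app2:
  assumes "pr 2 (\<lambda>xs. f (xs ! 0) (xs ! 1))" "pr n g" "pr n h"
  shows "pr n (\<lambda>xs. f (g xs) (h xs))"
  using pr_compose[of "[g, h]" "\<lambda>xs. f (xs ! 0) (xs ! 1)" n] assms
  by (auto simp: numeral_2_eq_2)

lemma pr_app3:
  assumes "pr 3 (\<lambda>xs. f (xs ! 0) (xs ! 1) (xs ! 2))" "pr n g" "pr n h" "pr n k"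
  shows "pr n (\<lambda>xs. f (g xs) (h xs) (k xs))"
  using pr_compose[of "[g, h, k]" "\<lambda>xs. f (xs ! 0) (xs ! 1) (xs ! 2)" n] assms
  by (auto simp: numeral_3_eq_3)

lemma primrec_unary_iff: "primrec_unary f \<longleftrightarrow> pr 1 (\<lambda>xs. f (xs ! 0))"
proof
  assume "primrec_unary f"
  from pr_app1[OF this pr_nth] show "pr 1 (\<lambda>xs. f (xs ! 0))"
    by simp
next
  assume "pr 1 (\<lambda>xs. f (xs ! 0))"
  then show "primrec_unary f"
    unfolding primrec_unary_def pr_def by force
qed

lemma primrec_set_iff: "primrec_set X \<longleftrightarrow> prp 1 (\<lambda>xs. xs ! 0 \<in> X)"
  using primrec_unary_iff[of "\<lambda>x. of_bool (x \<in> X)"]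
  unfolding primrec_set_def primrec_unary_def .

lemma prp_mem: "primrec_set X \<Longrightarrow> pr n f \<Longrightarrow> prp n (\<lambda>xs. f xs \<in> X)"
  using pr_app1[of "\<lambda>x. of_bool (x \<in> X)" n f] primrec_set_iff primrec_unary_iff by blast

lemma prp_rel:
  assumes "primrec_rel R" "pr n f" "pr n g" shows "prp n (\<lambda>xs. (f xs, g xs) \<in> R)"
proof -
  obtain c where c: "primrec_fun 2 c" "\<And>x y. c [x, y] = of_bool ((x, y) \<in> R)"
    using assms(1) unfolding primrec_rel_def by blast
  have "c xs = of_bool ((xs ! 0, xs ! 1) \<in> R)" if "length xs = 2" for xs
    using that c(2) by (auto simp: length_Suc_conv numeral_2_eq_2)
  then have "prp 2 (\<lambda>xs. (xs ! 0, xs ! 1) \<in> R)"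
    unfolding pr_def using c(1) by blast
  from pr_app2[OF this assms(2,3)] show ?thesis .
qed

lemma pr_sum:
  assumes f: "pr (Suc n) (\<lambda>ys. f (ys ! 0) (tl ys))" and b: "pr n b"
  shows "pr n (\<lambda>xs. \<Sum>i<b xs. f i xs)"
proof -
  have "pr (Suc (Suc n)) (\<lambda>ys. f (ys ! 0) (tl (tl ys)))"
    using f by (rule pr_skip)
  then have "pr n (\<lambda>xs. rec_nat 0 (\<lambda>k r. r + f k xs) (b xs))"
    by (intro pr_rec pr_add pr_nth pr_0 b) auto
  moreover have "rec_nat 0 (\<lambda>k r. r + F k) m = (\<Sum>i<m. F i)" for F :: "nat \<Rightarrow> nat" and m
    by (induction m) auto
  ultimately show ?thesis by simp
qed

lemma prp_bex:
  assumes "prp (Suc n) (\<lambda>ys. P (ys ! 0) (tl ys))" "pr n b"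
  shows "prp n (\<lambda>xs. \<exists>i<b xs. P i xs)"
  by (rule pr_cong[OF prp_pos[OF pr_sum[of n "\<lambda>i xs. of_bool (P i xs)", OF assms]]])
    (auto intro!: arg_cong[of _ _ of_bool])

lemma prp_ball:
  assumes "prp (Suc n) (\<lambda>ys. P (ys ! 0) (tl ys))" "pr n b"
  shows "prp n (\<lambda>xs. \<forall>i<b xs. P i xs)"
  using prp_not[OF prp_bex[of n "\<lambda>i xs. \<not> P i xs", OF prp_not[OF assms(1)] assms(2)]] by simp

text \<open>
  Bounded search as a sum: the least witness is the number of \<open>i\<close> such that no \<open>j \<le> i\<close> is a
  witness.
\<close>

lemma pr_Least:
  assumes P: "prp (Suc n) (\<lambda>ys. P (ys ! 0) (tl ys))" and b: "pr n b"
    and ex: "\<And>xs. length xs = n \<Longrightarrow> \<exists>y<b xs. P y xs"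
  shows "pr n (\<lambda>xs. LEAST y. P y xs)"
proof -
  have "prp (Suc (Suc n)) (\<lambda>ys. P (ys ! 0) (tl (tl ys)))"
    using P by (rule pr_skip[where f="\<lambda>i xs. of_bool (P i xs)"])
  then have "pr n (\<lambda>xs. \<Sum>i<b xs. of_bool (\<forall>j<Suc i. \<not> P j xs))"
    by (intro pr_sum prp_ball prp_not pr_Suc pr_nth b) auto
  then show ?thesis
  proof (rule pr_cong)
    fix xs :: "nat list" assume "length xs = n"
    then obtain y where y: "y < b xs" "P y xs" using ex by blast
    let ?L = "LEAST y. P y xs"
    have L: "P ?L xs" "?L < b xs"
      using y by (auto intro: LeastI le_less_trans[OF Least_le])
    have "(\<forall>j<Suc i. \<not> P j xs) \<longleftrightarrow> i < ?L" for i
      using L(1) not_less_Least by (metis leI less_Suc_eq_le less_le_trans not_less_eq)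
    then have "(\<Sum>i<b xs. of_bool (\<forall>j<Suc i. \<not> P j xs)) = (\<Sum>i<b xs. of_bool (i < ?L) :: nat)"
      by simp
    also have "\<dots> = card ({..<b xs} \<inter> {i. i < ?L})"
      by simp
    also have "{..<b xs} \<inter> {i. i < ?L} = {..<?L}"
      using L(2) by auto
    finally show "(\<Sum>i<b xs. of_bool (\<forall>j<Suc i. \<not> P j xs)) = ?L" by simp
  qed
qed

lemmas pr_intros = pr_nth pr_nth_tl pr_nth_tl_tl pr_const pr_Suc pr_add pr_diff pr_mult prp_not
  prp_conj prp_disj pr_if prp_less prp_le prp_eq

lemma pr_div2: assumes "pr n f" shows "pr n (\<lambda>xs. f xs div 2)"
proof -
  have "pr n (\<lambda>xs. rec_nat 0 (\<lambda>k r. if 2 * r = k then r else Suc r) (f xs))"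
    by (intro pr_rec pr_intros assms) auto
  moreover have "rec_nat 0 (\<lambda>k r. if 2 * r = k then r else Suc r) m = m div 2" for m :: nat
    by (induction m) auto
  ultimately show ?thesis by simp
qed

lemma prp_even: assumes "pr n f" shows "prp n (\<lambda>xs. even (f xs))"
proof -
  have "prp n (\<lambda>xs. 2 * (f xs div 2) = f xs)"
    by (intro pr_intros pr_div2 assms)
  moreover have "2 * (m div 2) = m \<longleftrightarrow> even m" for m :: nat
    by presburger
  ultimately show ?thesis by simp
qed

lemma pr_prod_encode: "pr n f \<Longrightarrow> pr n g \<Longrightarrow> pr n (\<lambda>xs. prod_encode (f xs, g xs))"
proof -
  assume a: "pr n f" "pr n g"
  have "triangle m = (\<Sum>i<Suc m. i)" for m
    by (induction m) auto
  then have t: "prod_encode (x, y) = (\<Sum>i<Suc (x + y). i) + x" for x y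
    by (simp add: prod_encode_def)
  show ?thesis
    unfolding t by (intro pr_intros pr_sum a) auto
qed

definition pfst :: "nat \<Rightarrow> nat" where "pfst z = fst (prod_decode z)"
definition psnd :: "nat \<Rightarrow> nat" where "psnd z = snd (prod_decode z)"

lemma pfst_encode [simp]: "pfst (prod_encode (x, y)) = x"
  and psnd_encode [simp]: "psnd (prod_encode (x, y)) = y"
  by (simp_all add: pfst_def psnd_def)

lemma prod_encode_pfst_psnd: "prod_encode (pfst z, psnd z) = z"
  by (simp add: pfst_def psnd_def)

lemma primrec_pfst: "primrec_unary pfst"
proof -
  have "pr 1 (\<lambda>xs. LEAST x. \<exists>y<Suc (xs ! 0). prod_encode (x, y) = xs ! 0)"
    by (intro pr_Least[where b="\<lambda>xs. Suc (xs ! 0)"] pr_intros prp_bex pr_prod_encode)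
      (auto, metis prod_encode_pfst_psnd le_prod_encode_1 le_prod_encode_2 le_imp_less_Suc)
  moreover have "(LEAST x. \<exists>y<Suc z. prod_encode (x, y) = z) = pfst z" for z
    by (rule Least_equality)
      (metis prod_encode_pfst_psnd le_prod_encode_2 le_imp_less_Suc, auto)
  ultimately show ?thesis unfolding primrec_unary_iff by simp
qed

lemma primrec_psnd: "primrec_unary psnd"
proof -
  have "pr 1 (\<lambda>xs. LEAST y. prod_encode (pfst (xs ! 0), y) = xs ! 0)"
    by (intro pr_Least[where b="\<lambda>xs. Suc (xs ! 0)"] pr_intros pr_prod_encode pr_app1[OF primrec_pfst])
      (auto, metis prod_encode_pfst_psnd le_prod_encode_2 le_imp_less_Suc)
  moreover have "(LEAST y. prod_encode (pfst z, y) = z) = psnd z" for z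
    by (rule Least_equality)
      (auto simp: prod_encode_pfst_psnd, metis psnd_encode order_refl)
  ultimately show ?thesis unfolding primrec_unary_iff by simp
qed

section \<open>A fast-growing hierarchy with primitive recursive graph\<close>

text \<open>
  With \<open>x + 2\<close> iterations, level \<open>k + 1\<close> bounds the twofold iterate of level \<open>k\<close> also at small
  arguments.  The two additional successors are the unit costs of the first and last step of the
  machine defined below, which make \<open>fast k x\<close> a reading of its clock.
\<close>

primrec fast :: "nat \<Rightarrow> nat \<Rightarrow> nat" where
  "fast 0 = Suc"
| "fast (Suc k) = (\<lambda>x. Suc ((fast k ^^ Suc (Suc x)) (Suc x)))"

lemma funpow_increasing:
  fixes f :: "nat \<Rightarrow> nat"
  assumes "\<And>x. x < f x" shows "x + n \<le> (f ^^ n) x"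
proof (induction n)
  case (Suc n)
  then show ?case using assms[of "(f ^^ n) x"] by simp
qed simp

lemma funpow_mono_exponent:
  fixes f :: "nat \<Rightarrow> nat"
  assumes "\<And>x. x < f x" "m \<le> n" shows "(f ^^ m) x \<le> (f ^^ n) x"
proof -
  have "(f ^^ n) x = (f ^^ (n - m)) ((f ^^ m) x)"
    using assms(2) by (metis comp_apply funpow_add le_add_diff_inverse2)
  then show ?thesis
    using funpow_increasing[OF assms(1), where x="(f ^^ m) x" and n="n - m"] by linarith
qed

lemma fast_greater: "x < fast k x"
proof (induction k arbitrary: x)
  case (Suc k)
  then show ?case using funpow_increasing[OF Suc, of "Suc x" "Suc (Suc x)"] by (simp del: funpow.simps)
qed simp

lemma mono_fast: "mono (fast k)"
proof (induction k)
  case 0 then show ?case by (simp add: mono_def)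
next
  case (Suc k)
  show ?case
  proof (rule monoI)
    fix x y :: nat assume xy: "x \<le> y"
    have "(fast k ^^ Suc (Suc x)) (Suc x) \<le> (fast k ^^ Suc (Suc y)) (Suc x)"
      using xy by (intro funpow_mono_exponent fast_greater) auto
    also have "\<dots> \<le> (fast k ^^ Suc (Suc y)) (Suc y)"
      using xy by (intro funpow_mono Suc) auto
    finally show "fast (Suc k) x \<le> fast (Suc k) y" by simp
  qed
qed

lemma fast_iterate_le:
  assumes "n \<le> Suc (Suc x)" shows "(fast k ^^ n) x \<le> fast (Suc k) x"
proof -
  have "(fast k ^^ n) x \<le> (fast k ^^ Suc (Suc x)) x"
    using assms by (intro funpow_mono_exponent fast_greater)
  also have "\<dots> \<le> (fast k ^^ Suc (Suc x)) (Suc x)"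
    by (intro funpow_mono mono_fast) simp
  finally show ?thesis by simp
qed

lemma fast_mono_level: "j \<le> k \<Longrightarrow> fast j x \<le> fast k x"
proof (induction k)
  case (Suc k)
  show ?case
  proof (cases "j \<le> k")
    case True
    then show ?thesis using Suc.IH fast_iterate_le[of 1 x k] by simp
  qed (use Suc.prems in \<open>auto simp: le_Suc_eq simp del: fast.simps\<close>)
qed simp

lemma primrec_fast: "primrec_unary (fast k)"
proof (induction k)
  case 0
  show ?case unfolding primrec_unary_iff by (auto intro: pr_intros)
next
  case (Suc k)
  have "pr 1 (\<lambda>xs. rec_nat (Suc (xs ! 0)) (\<lambda>i r. fast k r) (Suc (Suc (xs ! 0))))"
    by (intro pr_rec pr_app1[OF Suc] pr_Suc pr_nth) auto
  moreover have "rec_nat z (\<lambda>i r. fast k r) n = (fast k ^^ n) z" for z n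
    by (induction n) auto
  ultimately show ?case
    unfolding primrec_unary_iff by (auto intro: pr_Suc simp del: funpow.simps)
qed

text \<open>
  Composition costs one level because two applications of level \<open>K\<close> are below level \<open>K + 1\<close>; a
  recursion of length \<open>i \<le> m\<close> costs one level because \<open>i + 1\<close> applications are.
\<close>

lemma primrec_fun_majorized:
  "primrec_fun n f \<Longrightarrow> \<exists>k. \<forall>xs m. length xs = n \<longrightarrow> (\<forall>x\<in>set xs. x \<le> m) \<longrightarrow> f xs \<le> fast k m"
proof (induction rule: primrec_fun.induct)
  case (succ)
  show ?case by (intro exI[of _ 0]) (auto simp: length_Suc_conv)
next
  case (proj i n)
  show ?case using proj by (intro exI[of _ 0]) (auto intro!: le_SucI)
next
  case (comp hs g n)
  obtain k where k: "\<And>xs m. length xs = length hs \<Longrightarrow> (\<And>x. x \<in> set xs \<Longrightarrow> x \<le> m) \<Longrightarrow> g xs \<le> fast k m"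
    using comp.IH by blast
  obtain c where c: "\<And>h xs m. h \<in> set hs \<Longrightarrow> length xs = n \<Longrightarrow> (\<And>x. x \<in> set xs \<Longrightarrow> x \<le> m) \<Longrightarrow>
      h xs \<le> fast (c h) m"
    using comp.IH by metis
  define K where "K = Max (insert k (c ` set hs))"
  have K: "k \<le> K" "\<And>h. h \<in> set hs \<Longrightarrow> c h \<le> K"
    unfolding K_def by auto
  have "g (map (\<lambda>h. h xs) hs) \<le> fast (Suc K) m" if "length xs = n" "\<And>x. x \<in> set xs \<Longrightarrow> x \<le> m" for xs m
  proof -
    have "h xs \<le> fast K m" if "h \<in> set hs" for h
      using c[OF that, of xs m] fast_mono_level[OF K(2)[OF that], of m] \<open>length xs = n\<close>
        \<open>\<And>x. x \<in> set xs \<Longrightarrow> x \<le> m\<close> by fastforce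
    then have "g (map (\<lambda>h. h xs) hs) \<le> fast k (fast K m)"
      by (intro k) auto
    also have "\<dots> \<le> fast K (fast K m)"
      using K(1) by (rule fast_mono_level)
    also have "\<dots> \<le> fast (Suc K) m"
      using fast_iterate_le[of 2 m K] by (simp add: numeral_2_eq_2)
    finally show ?thesis .
  qed
  then show ?case by blast
next
  case (prec n g h)
  obtain k where k: "\<And>xs m. length xs = n \<Longrightarrow> (\<And>x. x \<in> set xs \<Longrightarrow> x \<le> m) \<Longrightarrow> g xs \<le> fast k m"
    using prec.IH by blast
  obtain l where l: "\<And>xs m. length xs = Suc (Suc n) \<Longrightarrow> (\<And>x. x \<in> set xs \<Longrightarrow> x \<le> m) \<Longrightarrow> h xs \<le> fast l m"
    using prec.IH by blast
  define K where "K = max k l"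
  have K: "k \<le> K" "l \<le> K" unfolding K_def by auto
  have *: "rec_nat (g ys) (\<lambda>i r. h (i # r # ys)) i \<le> (fast K ^^ Suc i) m"
    if "length ys = n" "\<And>x. x \<in> set ys \<Longrightarrow> x \<le> m" "i \<le> m" for ys i m
    using that(3)
  proof (induction i)
    case 0
    then show ?case using k[OF that(1,2)] fast_mono_level[OF K(1), of m] by force
  next
    case (Suc i)
    have m: "m \<le> (fast K ^^ Suc i) m"
      using funpow_increasing[of "fast K" m "Suc i", OF fast_greater] by linarith
    have "h (i # rec_nat (g ys) (\<lambda>i r. h (i # r # ys)) i # ys) \<le> fast l ((fast K ^^ Suc i) m)"
      using Suc that(1,2) m by (intro l) (auto intro: order_trans simp del: funpow.simps)
    also have "\<dots> \<le> fast K ((fast K ^^ Suc i) m)"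
      using K(2) by (rule fast_mono_level)
    finally show ?case by simp
  qed
  show ?case
  proof (intro exI[of _ "Suc K"] allI impI)
    fix xs :: "nat list" and m :: nat assume xs: "length xs = Suc n" "\<forall>x\<in>set xs. x \<le> m"
    then obtain i ys where ys: "xs = i # ys" by (auto simp: length_Suc_conv)
    have "rec_nat (g ys) (\<lambda>i r. h (i # r # ys)) i \<le> (fast K ^^ Suc i) m"
      using xs ys by (intro *) auto
    also have "\<dots> \<le> fast (Suc K) m"
      using xs ys by (intro fast_iterate_le) auto
    finally show "rec_nat (g (tl xs)) (\<lambda>k r. h (k # r # tl xs)) (hd xs) \<le> fast (Suc K) m"
      by (simp add: ys)
  qed
qed auto

lemma primrec_unary_majorized:
  assumes "primrec_unary f" obtains k where "\<And>j x. k \<le> j \<Longrightarrow> f x \<le> fast j x"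
proof -
  obtain g where g: "primrec_fun 1 g" "\<And>x. g [x] = f x"
    using assms unfolding primrec_unary_def by blast
  obtain k where k: "\<And>xs m. length xs = 1 \<Longrightarrow> (\<And>x. x \<in> set xs \<Longrightarrow> x \<le> m) \<Longrightarrow> g xs \<le> fast k m"
    using primrec_fun_majorized[OF g(1)] by blast
  have "f x \<le> fast j x" if "k \<le> j" for j x
    using k[of "[x]" x] g(2)[of x] fast_mono_level[OF that, of x] by simp
  then show ?thesis by (rule that)
qed

text \<open>
  A machine for the hierarchy.  In the state coded by \<open>(k, (c, r))\<close>, level \<open>k\<close> is to be applied \<open>c\<close> more
  times, and \<open>r\<close> codes the pending numbers of applications of the levels \<open>k + 1\<close>, \<open>k + 2\<close>, and so on.
  The value computed so far is not stored: it is the clock \<open>x\<close>, which advances by one with each step.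
\<close>

definition fast_step :: "nat \<Rightarrow> nat \<Rightarrow> nat" where
  "fast_step x s = (let k = pfst s; c = pfst (psnd s); r = psnd (psnd s) in
     if c = 0 then prod_encode (Suc k, r)
     else if k = 0 then prod_encode (0, prod_encode (c - 1, r))
     else prod_encode (k - 1, prod_encode (Suc (Suc x), prod_encode (c - 1, r))))"

primrec fast_run :: "nat \<Rightarrow> nat \<Rightarrow> nat \<Rightarrow> nat" where
  "fast_run x s 0 = s"
| "fast_run x s (Suc n) = fast_step (x + n) (fast_run x s n)"

lemma fast_run_add: "fast_run x s (m + n) = fast_run (x + m) (fast_run x s m) n"
  by (induction n) (auto simp: add.assoc)

text \<open>
  With \<open>t\<close> on level \<open>L + 1\<close>, the bound on the earlier levels identifies \<open>y\<close> as the first time at which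
  that level is reached.
\<close>

definition reach :: "nat \<Rightarrow> nat \<Rightarrow> nat \<Rightarrow> nat \<Rightarrow> nat \<Rightarrow> bool" where
  "reach L x s y t \<longleftrightarrow> (\<exists>n. x + n = y \<and> fast_run x s n = t \<and> (\<forall>m<n. pfst (fast_run x s m) \<le> L))"

lemma reach_trans:
  assumes "reach L x s y t" "reach L y t z u" shows "reach L x s z u"
proof -
  obtain m n where m: "x + m = y" "fast_run x s m = t" "\<And>i. i < m \<Longrightarrow> pfst (fast_run x s i) \<le> L"
    and n: "y + n = z" "fast_run y t n = u" "\<And>i. i < n \<Longrightarrow> pfst (fast_run y t i) \<le> L"
    using assms unfolding reach_def by blast
  have "pfst (fast_run x s i) \<le> L" if "i < m + n" for i
  proof (cases "i < m")
    case False
    then show ?thesis using fast_run_add[of x s m "i - m"] n(3)[of "i - m"] that m(1,2) by simp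
  qed (use m in auto)
  then show ?thesis
    unfolding reach_def using m n fast_run_add[of x s m n] by (intro exI[of _ "m + n"]) auto
qed

lemma reach_weaken: "reach L x s y t \<Longrightarrow> L \<le> M \<Longrightarrow> reach M x s y t"
  unfolding reach_def by (blast intro: order_trans)

lemma reach_step: "pfst s \<le> L \<Longrightarrow> fast_step x s = t \<Longrightarrow> reach L x s (Suc x) t"
  unfolding reach_def by (intro exI[of _ 1]) auto

lemma reach_fast:
  "reach k x (prod_encode (k, prod_encode (c, r))) (Suc ((fast k ^^ c) x)) (prod_encode (Suc k, r))"
proof (induction k arbitrary: x c r)
  case 0
  show ?case
  proof (induction c arbitrary: x)
    case 0
    show ?case by (simp add: reach_step fast_step_def)
  next
    case (Suc c)
    have "reach 0 x (prod_encode (0, prod_encode (Suc c, r))) (Suc x) (prod_encode (0, prod_encode (c, r)))"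
      by (intro reach_step) (auto simp: fast_step_def)
    from reach_trans[OF this Suc] show ?case by (simp add: funpow_swap1)
  qed
next
  case (Suc k)
  note IH = Suc.IH
  show ?case
  proof (induction c arbitrary: x)
    case 0
    show ?case by (simp add: reach_step fast_step_def)
  next
    case (Suc c)
    let ?s = "prod_encode (k, prod_encode (Suc (Suc x), prod_encode (c, r)))"
    have "reach (Suc k) x (prod_encode (Suc k, prod_encode (Suc c, r))) (Suc x) ?s"
      by (intro reach_step) (auto simp: fast_step_def)
    moreover have "reach (Suc k) (Suc x) ?s (fast (Suc k) x) (prod_encode (Suc k, prod_encode (c, r)))"
      using reach_weaken[OF IH[of "Suc x" "Suc (Suc x)" "prod_encode (c, r)"], of "Suc k"] by simp
    moreover have "(fast (Suc k) ^^ Suc c) x = (fast (Suc k) ^^ c) (fast (Suc k) x)"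
      by (simp only: funpow_Suc_right comp_apply)
    ultimately show ?case
      using reach_trans[OF reach_trans Suc] by metis
  qed
qed

text \<open>
  The code \<open>0\<close> stands for no pending applications at all levels above, since \<open>(0, 0)\<close> has code \<open>0\<close>.  So
  the machine does not halt but climbs one level per step.
\<close>

lemma fast_run_pops: "fast_run x (prod_encode (j, 0)) n = prod_encode (j + n, 0)"
proof (induction n)
  case (Suc n)
  have "pfst 0 = 0" "psnd 0 = 0"
    using pfst_encode[of 0 0] psnd_encode[of 0 0] by (simp_all add: prod_encode_def)
  then show ?case using Suc by (simp add: fast_step_def)
qed simp

text \<open>
  Started with one application of level \<open>j\<close>, the machine stays on levels up to \<open>j\<close> until it is done, and
  climbs one level per step afterwards.  It is on level \<open>j + 1\<close> at exactly one time.
\<close>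

lemma fast_graph:
  "s = Suc (fast j x) \<longleftrightarrow>
     x \<le> s \<and> pfst (fast_run x (prod_encode (j, prod_encode (1, 0))) (s - x)) = Suc j" (is "_ \<longleftrightarrow> ?R")
proof -
  let ?s = "prod_encode (j, prod_encode (1, 0))"
  obtain n where n: "x + n = Suc (fast j x)" "fast_run x ?s n = prod_encode (Suc j, 0)"
      "\<And>m. m < n \<Longrightarrow> pfst (fast_run x ?s m) \<le> j"
    using reach_fast[of j x 1 0] unfolding reach_def by auto
  show ?thesis
  proof
    assume "s = Suc (fast j x)"
    then have "x \<le> s" "s - x = n" using n(1) by auto
    then show ?R using n(2) by simp
  next
    assume R: ?R
    have "n \<le> s - x"
      using n(3)[of "s - x"] R by force
    then have "fast_run x ?s (s - x) = prod_encode (Suc j + (s - x - n), 0)"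
      using fast_run_add[of x ?s n "s - x - n"] n(2)
        fast_run_pops[of "x + n" "Suc j" "s - x - n"]
      by (metis le_add_diff_inverse)
    then have "s - x - n = 0" using R by simp
    then have "s - x = n" using \<open>n \<le> s - x\<close> by linarith
    then show "s = Suc (fast j x)" using R n(1) by linarith
  qed
qed

lemma pr_fast_run: "pr n f \<Longrightarrow> pr n g \<Longrightarrow> pr n h \<Longrightarrow> pr n (\<lambda>xs. fast_run (f xs) (g xs) (h xs))"
proof -
  assume a: "pr n f" "pr n g" "pr n h"
  have m: "pr 2 (\<lambda>xs. fast_step (xs ! 0) (xs ! 1))"
    unfolding fast_step_def Let_def
    by (intro pr_intros pr_prod_encode pr_app1[OF primrec_pfst] pr_app1[OF primrec_psnd]) auto
  have "pr 3 (\<lambda>xs. rec_nat (xs ! 1) (\<lambda>k r. fast_step (xs ! 0 + k) r) (xs ! 2))"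
    by (intro pr_rec pr_app2[OF m] pr_intros) auto
  moreover have "rec_nat s (\<lambda>k r. fast_step (x + k) r) m = fast_run x s m" for x s m
    by (induction m) auto
  ultimately have "pr 3 (\<lambda>xs. fast_run (xs ! 0) (xs ! 1) (xs ! 2))" by simp
  from pr_app3[OF this a] show ?thesis .
qed

lemma prp_fast_graph:
  assumes "pr n f" "pr n g" "pr n h"
  shows "prp n (\<lambda>xs. f xs = Suc (fast (g xs) (h xs)))"
  unfolding fast_graph
  by (intro pr_intros pr_app1[OF primrec_pfst] pr_fast_run pr_prod_encode assms)

section \<open>Counting functions ordered up to primitive recursive speed-up\<close>

text \<open>
  The condition \<open>u 1 = 1\<close> reflects that the number \<open>0\<close> always opens a class.
\<close>

definition counting_fun :: "(nat \<Rightarrow> nat) \<Rightarrow> bool" where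
  "counting_fun u \<longleftrightarrow> primrec_unary u \<and> u 0 = 0 \<and> u 1 = 1 \<and> (\<forall>s. u s \<le> u (Suc s) \<and> u (Suc s) \<le> Suc (u s)) \<and>
     (\<forall>n. \<exists>s. n \<le> u s)"

definition speed_le :: "(nat \<Rightarrow> nat) \<Rightarrow> (nat \<Rightarrow> nat) \<Rightarrow> bool" where
  "speed_le u v \<longleftrightarrow> (\<exists>h. primrec_unary h \<and> (\<forall>s. u s \<le> v (h s)))"

lemma counting_fun_mono: "counting_fun u \<Longrightarrow> mono u"
  unfolding counting_fun_def by (simp add: mono_iff_le_Suc)

lemma counting_fun_le: "counting_fun u \<Longrightarrow> s \<le> t \<Longrightarrow> u s \<le> u t"
  using counting_fun_mono monoD by blast

lemma counting_fun_le_id: assumes "counting_fun u" shows "u s \<le> s"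
proof (induction s)
  case (Suc s) then show ?case using assms unfolding counting_fun_def by (metis Suc_le_mono order_trans)
qed (use assms in \<open>auto simp: counting_fun_def\<close>)

lemma counting_fun_id: "counting_fun (\<lambda>s. s)"
  unfolding counting_fun_def using primrec_unary_id by auto

lemma speed_le_trans: "speed_le u v \<Longrightarrow> speed_le v w \<Longrightarrow> speed_le u w"
  unfolding speed_le_def by (metis primrec_unary_comp order_trans)

lemma speed_le_pointwise: "(\<And>s. u s \<le> v s) \<Longrightarrow> speed_le u v"
  unfolding speed_le_def using primrec_unary_id by blast

lemma mono_majorant:
  assumes "primrec_unary h"
  shows "\<exists>h'. primrec_unary h' \<and> mono h' \<and> (\<forall>s. h s \<le> h' s)"
proof (intro exI conjI allI)
  show "primrec_unary (\<lambda>s. \<Sum>i<Suc s. h i)"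
    unfolding primrec_unary_iff
    by (intro pr_intros pr_sum pr_app1[OF assms]) auto
  show "mono (\<lambda>s. \<Sum>i<Suc s. h i)"
    by (simp add: mono_iff_le_Suc)
qed simp

lemma speed_le_witness:
  assumes "speed_le u v" "counting_fun v"
  shows "\<exists>h. primrec_unary h \<and> mono h \<and> (\<forall>s. u s \<le> v (h s))"
proof -
  obtain h where h: "primrec_unary h" "\<And>s. u s \<le> v (h s)"
    using assms(1) unfolding speed_le_def by blast
  obtain h' where h': "primrec_unary h'" "mono h'" "\<And>s. h s \<le> h' s"
    using mono_majorant[OF h(1)] by metis
  have "u s \<le> v (h' s)" for s
    using h(2)[of s] counting_fun_le[OF assms(2) h'(3)[of s]] by linarith
  then show ?thesis using h'(1,2) by blast
qed

lemma counting_fun_lattice: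
  assumes "counting_fun u" "counting_fun v"
  shows counting_fun_max: "counting_fun (\<lambda>s. max (u s) (v s))"
    and counting_fun_min: "counting_fun (\<lambda>s. min (u s) (v s))"
proof -
  have p: "primrec_unary u" "primrec_unary v" using assms unfolding counting_fun_def by auto
  have m: "primrec_unary (\<lambda>s. max (u s) (v s))" "primrec_unary (\<lambda>s. min (u s) (v s))"
    unfolding primrec_unary_iff max_def min_def
    by (intro pr_intros pr_app1[OF p(1)] pr_app1[OF p(2)]; simp)+
  have s: "u s \<le> u (Suc s)" "u (Suc s) \<le> Suc (u s)" "v s \<le> v (Suc s)" "v (Suc s) \<le> Suc (v s)" for s
    using assms unfolding counting_fun_def by auto
  have unb: "\<exists>s. n \<le> min (u s) (v s)" for n
  proof -
    obtain s t where "n \<le> u s" "n \<le> v t" using assms unfolding counting_fun_def by blast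
    then have "n \<le> u (max s t)" "n \<le> v (max s t)"
      using counting_fun_le[OF assms(1), of s "max s t"] counting_fun_le[OF assms(2), of t "max s t"] by auto
    then show ?thesis by auto
  qed
  then have unb': "\<exists>s. n \<le> max (u s) (v s)" for n
    by (meson max.coboundedI1 min.cobounded1 order_trans)
  have "max (u s) (v s) \<le> max (u (Suc s)) (v (Suc s)) \<and> max (u (Suc s)) (v (Suc s)) \<le> Suc (max (u s) (v s))"
       "min (u s) (v s) \<le> min (u (Suc s)) (v (Suc s)) \<and> min (u (Suc s)) (v (Suc s)) \<le> Suc (min (u s) (v s))" for s
    using s[of s] by auto
  then show "counting_fun (\<lambda>s. max (u s) (v s))" "counting_fun (\<lambda>s. min (u s) (v s))"
    using assms m unb unb' unfolding counting_fun_def by auto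
qed

lemma speed_le_max:
  assumes "counting_fun w" "speed_le u w" "speed_le v w" shows "speed_le (\<lambda>s. max (u s) (v s)) w"
proof -
  obtain g where g: "primrec_unary g" "\<And>s. u s \<le> w (g s)"
    using assms(2) unfolding speed_le_def by blast
  obtain h where h: "primrec_unary h" "\<And>s. v s \<le> w (h s)"
    using assms(3) unfolding speed_le_def by blast
  have "max (u s) (v s) \<le> w (g s + h s)" for s
    using g(2)[of s] h(2)[of s] counting_fun_le[OF assms(1), of "g s" "g s + h s"]
      counting_fun_le[OF assms(1), of "h s" "g s + h s"]
    by auto
  moreover have "primrec_unary (\<lambda>s. g s + h s)"
    unfolding primrec_unary_iff by (intro pr_intros pr_app1[OF g(1)] pr_app1[OF h(1)]) auto
  ultimately show ?thesis unfolding speed_le_def by (intro exI[of _ "\<lambda>s. g s + h s"]) auto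
qed

lemma speed_le_min:
  assumes "counting_fun u" "counting_fun v" "speed_le w u" "speed_le w v" shows "speed_le w (\<lambda>s. min (u s) (v s))"
proof -
  obtain g where g: "primrec_unary g" "\<And>s. w s \<le> u (g s)"
    using assms(3) unfolding speed_le_def by blast
  obtain h where h: "primrec_unary h" "\<And>s. w s \<le> v (h s)"
    using assms(4) unfolding speed_le_def by blast
  have "w s \<le> min (u (g s + h s)) (v (g s + h s))" for s
    using g(2)[of s] h(2)[of s] counting_fun_le[OF assms(1), of "g s" "g s + h s"]
      counting_fun_le[OF assms(2), of "h s" "g s + h s"]
    by auto
  moreover have "primrec_unary (\<lambda>s. g s + h s)"
    unfolding primrec_unary_iff by (intro pr_intros pr_app1[OF g(1)] pr_app1[OF h(1)]) auto
  ultimately show ?thesis unfolding speed_le_def by (intro exI[of _ "\<lambda>s. g s + h s"]) auto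
qed

section \<open>Degrees of punctual equivalence relations as growth rates\<close>

definition leaders :: "nat rel \<Rightarrow> nat set" where
  "leaders R = {x. \<forall>y<x. (y, x) \<notin> R}"

definition num_classes :: "nat rel \<Rightarrow> nat \<Rightarrow> nat" where
  "num_classes R s = card {x. x < s \<and> x \<in> leaders R}"

definition least_rep :: "nat rel \<Rightarrow> nat \<Rightarrow> nat" where
  "least_rep R x = (LEAST y. (y, x) \<in> R)"

lemma card_below_Suc:
  "card {x. x < Suc s \<and> x \<in> A} = card {x. x < s \<and> x \<in> A} + of_bool (s \<in> A)"
proof -
  have "{x. x < Suc s \<and> x \<in> A} = {x. x < s \<and> x \<in> A} \<union> (if s \<in> A then {s} else {})"
    by (auto simp: less_Suc_eq)
  then show ?thesis by (simp add: card_insert_if)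
qed

lemma num_classes_Suc: "num_classes R (Suc s) = num_classes R s + of_bool (s \<in> leaders R)"
  unfolding num_classes_def by (rule card_below_Suc)

lemma num_classes_0 [simp]: "num_classes R 0 = 0"
  unfolding num_classes_def by simp

lemma num_classes_mono: "s \<le> t \<Longrightarrow> num_classes R s \<le> num_classes R t"
  unfolding num_classes_def by (intro card_mono) auto

lemma num_classes_strict: "x \<in> leaders R \<Longrightarrow> x < y \<Longrightarrow> num_classes R x < num_classes R y"
  using num_classes_mono[of "Suc x" y R] num_classes_Suc[of R x] by simp

lemma num_classes_inj: "x \<in> leaders R \<Longrightarrow> y \<in> leaders R \<Longrightarrow> num_classes R x = num_classes R y \<longleftrightarrow> x = y"
  using num_classes_strict[of x R y] num_classes_strict[of y R x] by (metis linorder_neqE_nat nat_less_le)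

lemma num_classes_attained: "i < num_classes R t \<Longrightarrow> \<exists>y<t. y \<in> leaders R \<and> num_classes R y = i"
proof (induction t)
  case (Suc t)
  then show ?case by (cases "t \<in> leaders R") (auto simp: num_classes_Suc less_Suc_eq)
qed simp

lemma least_rep_props:
  assumes "equiv UNIV R"
  shows least_rep_rel: "(least_rep R x, x) \<in> R"
    and least_rep_le: "least_rep R x \<le> x" and least_rep_leader: "least_rep R x \<in> leaders R"
proof -
  have r: "(x, x) \<in> R" using assms by (auto simp: equiv_def refl_on_def)
  show 1: "(least_rep R x, x) \<in> R" unfolding least_rep_def using r by (rule LeastI)
  show "least_rep R x \<le> x" unfolding least_rep_def using r by (rule Least_le)
  show "least_rep R x \<in> leaders R" unfolding leaders_def
  proof (intro CollectI allI impI notI)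
    fix y assume y: "y < least_rep R x" "(y, least_rep R x) \<in> R"
    then have "(y, x) \<in> R" using 1 assms by (meson equiv_def transD)
    then show False using y(1) unfolding least_rep_def using not_less_Least by blast
  qed
qed

lemma least_rep_eq_iff:
  assumes "equiv UNIV R" shows "least_rep R x = least_rep R y \<longleftrightarrow> (x, y) \<in> R"
proof
  assume "least_rep R x = least_rep R y"
  then show "(x, y) \<in> R"
    using least_rep_rel[OF assms, of x] least_rep_rel[OF assms, of y] assms by (metis equiv_def symD transD)
next
  assume "(x, y) \<in> R"
  then have "(z, x) \<in> R \<longleftrightarrow> (z, y) \<in> R" for z
    using assms by (metis equiv_def symD transD)
  then show "least_rep R x = least_rep R y" unfolding least_rep_def by simp
qed

lemma least_rep_of_leader: "equiv UNIV R \<Longrightarrow> x \<in> leaders R \<Longrightarrow> least_rep R x = x"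
  using least_rep_rel[of R x] least_rep_le[of R x] by (auto simp: leaders_def le_less)

lemma leaders_related:
  assumes "equiv UNIV R" "x \<in> leaders R" "y \<in> leaders R" "(x, y) \<in> R" shows "x = y"
  using assms least_rep_eq_iff least_rep_of_leader by metis

lemma prp_leaders:
  assumes "primrec_rel R" "pr n f" shows "prp n (\<lambda>xs. f xs \<in> leaders R)"
proof -
  have "prp 1 (\<lambda>xs. \<forall>y<xs ! 0. (y, xs ! 0) \<notin> R)"
    by (intro prp_ball prp_not prp_rel[OF assms(1)] pr_intros) auto
  then have "primrec_set (leaders R)" unfolding primrec_set_iff leaders_def by simp
  then show ?thesis using assms(2) by (rule prp_mem)
qed

lemma primrec_num_classes: assumes "primrec_rel R" shows "primrec_unary (num_classes R)"
proof -
  have "pr 1 (\<lambda>xs. \<Sum>i<xs ! 0. of_bool (i \<in> leaders R))"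
    by (intro pr_sum prp_leaders[OF assms] pr_nth) auto
  moreover have "(\<Sum>i<s. of_bool (i \<in> leaders R)) = num_classes R s" for s
    by (induction s) (auto simp: num_classes_Suc)
  ultimately show ?thesis unfolding primrec_unary_iff by simp
qed

lemma infinite_leaders:
  assumes "equiv UNIV R" "infinite (UNIV // R)" shows "infinite (leaders R)"
proof
  assume "finite (leaders R)"
  moreover have "UNIV // R \<subseteq> (\<lambda>x. R `` {x}) ` leaders R"
  proof
    fix C assume "C \<in> UNIV // R"
    then obtain x where "C = R `` {x}" by (auto simp: quotient_def)
    also have "R `` {x} = R `` {least_rep R x}"
      using least_rep_rel[OF assms(1), of x] assms(1) by (metis equiv_class_eq_iff)
    finally show "C \<in> (\<lambda>x. R `` {x}) ` leaders R"
      using least_rep_leader[OF assms(1), of x] by blast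
  qed
  ultimately show False using assms(2) finite_surj by blast
qed

lemma num_classes_unbounded:
  assumes "infinite (leaders R)" shows "\<exists>s. n \<le> num_classes R s"
proof -
  obtain A where A: "A \<subseteq> leaders R" "finite A" "card A = n"
    using infinite_arbitrarily_large[OF assms] by blast
  have "A \<subseteq> {x. x < Suc (Max A) \<and> x \<in> leaders R}"
    using A by (auto simp: less_Suc_eq_le)
  then have "card A \<le> num_classes R (Suc (Max A))" unfolding num_classes_def by (intro card_mono) auto
  then show ?thesis using A(3) by blast
qed

lemma counting_fun_num_classes: assumes "punctual_equiv R" shows "counting_fun (num_classes R)"
proof -
  have "num_classes R 1 = 1" using num_classes_Suc[of R 0] by (simp add: leaders_def)
  then show ?thesis
    using assms primrec_num_classes[of R] num_classes_unbounded[OF infinite_leaders[of R]]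
    unfolding punctual_equiv_def counting_fun_def by (simp add: num_classes_Suc)
qed

lemma primrec_least_rep: assumes "primrec_rel R" "equiv UNIV R" shows "primrec_unary (least_rep R)"
proof -
  have "pr 1 (\<lambda>xs. LEAST y. (y, xs ! 0) \<in> R)"
    using least_rep_rel[OF assms(2)] least_rep_le[OF assms(2)]
    by (intro pr_Least[where b="\<lambda>xs. Suc (xs ! 0)"] prp_rel[OF assms(1)] pr_intros)
      (auto simp: less_Suc_eq_le)
  then show ?thesis unfolding primrec_unary_iff least_rep_def .
qed

text \<open>
  A reduction maps the classes that meet \<open>{..<s}\<close> injectively to classes that meet \<open>{..<h s}\<close> when \<open>h s\<close>
  exceeds all values taken.  Conversely, the \<open>i\<close>-th class of \<open>R\<close>, in the order in which classes
  appear, is sent to the least element of the \<open>i\<close>-th class of \<open>S\<close>; the bound \<open>h\<close> makes the search for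
  it primitive recursive.
\<close>

theorem pr_le_iff_speed_le:
  assumes R: "punctual_equiv R" and S: "punctual_equiv S"
  shows "R \<le>pr S \<longleftrightarrow> speed_le (num_classes R) (num_classes S)"
proof
  have eR: "equiv UNIV R" and eS: "equiv UNIV S" using R S unfolding punctual_equiv_def by auto
  have pR: "primrec_rel R" and pS: "primrec_rel S" using R S unfolding punctual_equiv_def by auto
  {
    assume "R \<le>pr S"
    then obtain f where f: "primrec_unary f" "\<And>x y. (x, y) \<in> R \<longleftrightarrow> (f x, f y) \<in> S"
      unfolding pr_le_def by blast
    define h where "h s = Suc (\<Sum>i<s. f i)" for s
    have "primrec_unary h"
      unfolding h_def primrec_unary_iff by (intro pr_intros pr_sum pr_app1[OF f(1)]) auto
    moreover have "num_classes R s \<le> num_classes S (h s)" for s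
      unfolding num_classes_def
    proof (rule card_inj_on_le[of "\<lambda>x. least_rep S (f x)"])
      show "inj_on (\<lambda>x. least_rep S (f x)) {x. x < s \<and> x \<in> leaders R}"
        by (rule inj_onI) (auto simp: least_rep_eq_iff[OF eS] f(2)[symmetric] intro: leaders_related[OF eR])
      have "f x < h s" if "x < s" for x
        unfolding h_def using member_le_sum[of x "{..<s}" f] that by simp
      then show "(\<lambda>x. least_rep S (f x)) ` {x. x < s \<and> x \<in> leaders R} \<subseteq> {x. x < h s \<and> x \<in> leaders S}"
        using least_rep_le[OF eS] least_rep_leader[OF eS] by (auto intro: le_less_trans)
    qed auto
    ultimately show "speed_le (num_classes R) (num_classes S)" unfolding speed_le_def by blast
  next
    assume "speed_le (num_classes R) (num_classes S)"
    then obtain h where h: "primrec_unary h" "\<And>s. num_classes R s \<le> num_classes S (h s)"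
      unfolding speed_le_def by blast
    define P where "P x y \<longleftrightarrow> y \<in> leaders S \<and> num_classes S y = num_classes R (least_rep R x)" for x y
    define f where "f x = (LEAST y. P x y)" for x
    have ex: "\<exists>y<h (Suc x). P x y" for x
    proof -
      have "num_classes R (least_rep R x) < num_classes R (Suc x)"
        using least_rep_leader[OF eR] least_rep_le[OF eR] by (intro num_classes_strict) (auto simp: less_Suc_eq_le)
      then show ?thesis unfolding P_def using num_classes_attained h(2) less_le_trans by blast
    qed
    have "pr 1 (\<lambda>xs. LEAST y. P (xs ! 0) y)"
      unfolding P_def
      by (intro pr_Least[where b="\<lambda>xs. h (Suc (xs ! 0))"] prp_leaders[OF pS] pr_app1[OF primrec_num_classes[OF pS]]
          pr_app1[OF primrec_num_classes[OF pR]] pr_app1[OF primrec_least_rep[OF pR eR]] pr_app1[OF h(1)] pr_intros)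
        (use ex in \<open>auto simp: P_def\<close>)
    then have "primrec_unary f" unfolding f_def primrec_unary_iff .
    moreover have fP: "f x \<in> leaders S" "num_classes S (f x) = num_classes R (least_rep R x)" for x
      using ex[of x] LeastI[of "P x"] unfolding f_def P_def by blast+
    have "(x, y) \<in> R \<longleftrightarrow> (f x, f y) \<in> S" for x y
    proof -
      have "(x, y) \<in> R \<longleftrightarrow> least_rep R x = least_rep R y" by (simp add: least_rep_eq_iff[OF eR])
      also have "\<dots> \<longleftrightarrow> num_classes S (f x) = num_classes S (f y)"
        by (simp add: fP(2) num_classes_inj least_rep_leader[OF eR])
      also have "\<dots> \<longleftrightarrow> f x = f y"
        by (simp add: fP(1) num_classes_inj)
      also have "\<dots> \<longleftrightarrow> (f x, f y) \<in> S"
        using leaders_related[OF eS fP(1) fP(1)] eS by (metis UNIV_I equiv_def refl_onD)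
      finally show ?thesis .
    qed
    ultimately show "R \<le>pr S" unfolding pr_le_def by blast
  }
qed

lemma leaders_set_rel: "leaders (set_rel U) = {x. x \<in> U \<longrightarrow> (\<forall>y<x. y \<notin> U)}"
  unfolding leaders_def set_rel_def by auto

lemma num_classes_set_rel:
  "num_classes (set_rel U) s = card {i. i < s \<and> i \<in> - U} + of_bool (\<exists>i<s. i \<in> U)"
proof (induction s)
  case (Suc s)
  show ?case
    by (simp only: num_classes_Suc Suc card_below_Suc leaders_set_rel) (auto simp: less_Suc_eq)
qed simp

text \<open>
  The elements outside \<open>U\<close> are the positive stages at which \<open>u\<close> increases; \<open>U\<close> itself is the class
  opened at stage \<open>0\<close>.
\<close>

lemma counting_fun_realised:
  assumes "counting_fun u" obtains R where "punctual_equiv R" "num_classes R = u"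
proof -
  define U where "U = {s. s = 0 \<or> u (Suc s) = u s}"
  have pu: "primrec_unary u" and u: "u 0 = 0" "u 1 = 1" "\<And>s. u s \<le> u (Suc s)" "\<And>s. u (Suc s) \<le> Suc (u s)"
      "\<And>n. \<exists>s. n \<le> u s"
    using assms unfolding counting_fun_def by auto
  have "primrec_set U"
    unfolding primrec_set_iff U_def mem_Collect_eq by (intro pr_intros pr_app1[OF pu]) auto
  moreover have c: "card {i. i < s \<and> i \<in> - U} + of_bool (0 < s) = u s" for s
  proof (induction s)
    case (Suc s)
    show ?case
    proof (cases "s = 0")
      case True
      then have "{i. i < Suc s \<and> i \<in> - U} = {}" by (auto simp: U_def)
      then show ?thesis using True u(2) by (simp only: card.empty) simp
    next
      case False
      then show ?thesis using Suc u(3,4)[of s] card_below_Suc[of s "- U"] by (auto simp: U_def)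
    qed
  qed (simp add: u)
  moreover have "infinite (- U)"
  proof
    assume fin: "finite (- U)"
    obtain s where "card (- U) + 2 \<le> u s" using u(5) by blast
    moreover have "card {i. i < s \<and> i \<in> - U} \<le> card (- U)"
      using fin by (intro card_mono) auto
    ultimately show False using c[of s] by (cases "s = 0") simp_all
  qed
  moreover have "num_classes (set_rel U) = u"
  proof
    fix s
    have "(\<exists>i<s. i \<in> U) \<longleftrightarrow> 0 < s" by (auto simp: U_def)
    then show "num_classes (set_rel U) s = u s" using c[of s] by (simp add: num_classes_set_rel)
  qed
  ultimately show ?thesis using that punctual_equiv_set_rel by blast
qed

section \<open>Splittings of growth rates\<close>

text \<open>
  Shifting the argument of \<open>h\<close> by \<open>s0\<close> absorbs the finitely many exceptions.
\<close>

lemma top_if_eventually: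
  assumes "counting_fun b" "primrec_unary h" "\<And>s. s0 \<le> s \<Longrightarrow> s \<le> b (h s)"
  shows "speed_le (\<lambda>s. s) b"
proof -
  have "s \<le> b (h (s + s0))" for s
    using assms(3)[of "s + s0"] by simp
  moreover have "primrec_unary (\<lambda>s. h (s + s0))"
    unfolding primrec_unary_iff by (intro pr_app1[OF assms(2)] pr_intros) auto
  ultimately show ?thesis unfolding speed_le_def by (intro exI[of _ "\<lambda>s. h (s + s0)"]) auto
qed

text \<open>
  The meet \<open>u\<close> of \<open>b\<close> and \<open>c\<close> grows too slowly for one of them to take over from the other the task of
  keeping pace with the identity.
\<close>

lemma no_split_if_dominated:
  assumes b: "counting_fun b" and c: "counting_fun c"
    and dom: "\<And>h. primrec_unary h \<Longrightarrow> \<exists>s0. \<forall>s\<ge>s0. u (h s) < s"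
    and meet: "speed_le (\<lambda>s. min (b s) (c s)) u"
    and join: "speed_le (\<lambda>s. s) (\<lambda>s. max (b s) (c s))"
  shows "speed_le (\<lambda>s. s) b \<or> speed_le (\<lambda>s. s) c"
proof -
  obtain h where h: "primrec_unary h" "mono h" "\<And>s. s \<le> max (b (h s)) (c (h s))"
    using speed_le_witness[OF join counting_fun_max[OF b c]] by metis
  obtain g where g: "primrec_unary g" "\<And>s. min (b s) (c s) \<le> u (g s)"
    using meet unfolding speed_le_def by blast
  have "primrec_unary (\<lambda>s. g (h (Suc s)))"
    unfolding primrec_unary_iff by (intro pr_app1[OF g(1)] pr_app1[OF h(1)] pr_intros) auto
  then obtain s0 where s0: "\<And>s. s0 \<le> s \<Longrightarrow> u (g (h (Suc s))) < s"
    using dom by blast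
  have meet_small: "min (b (h (Suc s))) (c (h (Suc s))) < s" if "s0 \<le> s" for s
    using g(2)[of "h (Suc s)"] s0[OF that] by linarith
  have hs: "h s \<le> h (Suc s)" for s using h(2) by (simp add: mono_def)
  have mon: "b (h s) \<le> b (h (Suc s))" "c (h s) \<le> c (h (Suc s))" for s
    using counting_fun_le[OF b hs] counting_fun_le[OF c hs] by auto
  show ?thesis
  proof (cases "s0 \<le> b (h s0)")
    case True
    have "s \<le> b (h s)" if "s0 \<le> s" for s
      using that
    proof (induction s rule: dec_induct)
      case (step s)
      then show ?case using meet_small[of s] mon[of s] h(3)[of "Suc s"] by linarith
    qed (rule True)
    then show ?thesis using top_if_eventually[OF b h(1)] by blast
  next
    case False
    then have "s0 \<le> c (h s0)" using h(3)[of s0] by linarith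
    have "s \<le> c (h s)" if "s0 \<le> s" for s
      using that
    proof (induction s rule: dec_induct)
      case (step s)
      then show ?case using meet_small[of s] mon[of s] h(3)[of "Suc s"] by linarith
    qed (rule \<open>s0 \<le> c (h s0)\<close>)
    then show ?thesis using top_if_eventually[OF c h(1)] by blast
  qed
qed

text \<open>
  Let \<open>h \<ge> f\<close> be monotone.  The \<open>n\<close>-th element of the complement is at least \<open>n\<close>, so by slowness the
  next one exceeds \<open>h (n + 4)\<close>.  With \<open>s = n + 4\<close>, at most \<open>s - 3\<close> elements of the complement are below \<open>h s\<close>, and \<open>X\<close> contributes
  one more class.
\<close>

lemma slow_dominates:
  assumes "infinite (- X)" "slow X" "primrec_unary f"
  shows "\<exists>s0. \<forall>s\<ge>s0. num_classes (set_rel X) (f s) < s"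
proof -
  let ?p = "enumerate (- X)"
  obtain h where h: "primrec_unary h" "mono h" "\<And>s. f s \<le> h s"
    using mono_majorant[OF assms(3)] by metis
  have "primrec_unary (\<lambda>x. h (x + 4))"
    unfolding primrec_unary_iff by (intro pr_app1[OF h(1)] pr_intros) auto
  then obtain N where N: "\<And>n. N \<le> n \<Longrightarrow> h (?p n + 4) < ?p (Suc n)"
    using assms(2) unfolding slow_def MOST_nat_le by blast
  have "num_classes (set_rel X) (f s) < s" if s: "N + 4 \<le> s" for s
  proof -
    define n where "n = s - 4"
    have n: "N \<le> n" "s = n + 4" using s unfolding n_def by auto
    have "h s \<le> h (?p n + 4)"
      using le_enumerate[OF assms(1), of n] n(2) by (intro monoD[OF h(2)]) simp
    then have lt: "f s < ?p (Suc n)"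
      using N[OF n(1)] h(3)[of s] by linarith
    have "{i. i < f s \<and> i \<in> - X} \<subseteq> ?p ` {..<Suc n}"
    proof
      fix i assume i: "i \<in> {i. i < f s \<and> i \<in> - X}"
      then obtain m where m: "i = ?p m" using enumerate_Ex[OF assms(1)] by blast
      then have "?p m < ?p (Suc n)" using i lt by simp
      then have "m < Suc n" using enumerate_mono_iff[OF assms(1)] by blast
      then show "i \<in> ?p ` {..<Suc n}" using m by blast
    qed
    then have "card {i. i < f s \<and> i \<in> - X} \<le> card (?p ` {..<Suc n})"
      by (intro card_mono) auto
    also have "\<dots> \<le> Suc n" using card_image_le[of "{..<Suc n}" ?p] by simp
    finally show ?thesis using n(2) by (simp add: num_classes_set_rel)
  qed
  then show ?thesis by blast
qed

text \<open>
  The common frame of both diagonal constructions: \<open>q\<close> counts completed phases, \<open>T m s\<close> is the event that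
  ends phase \<open>m\<close> at stage \<open>s\<close>, and no phase lasts forever since its event recurs.
\<close>

lemma phases:
  fixes q :: "nat \<Rightarrow> nat"
  assumes q: "q 0 = 0" "\<And>s. q (Suc s) = q s + of_bool (T (q s) s)"
    and T: "\<And>m s0. \<exists>s\<ge>s0. T m s"
  shows "\<exists>s. q s = m \<and> T m s"
proof -
  have step: "\<exists>s. q s = m \<and> T m s" if s0: "q s0 = m" for m s0
  proof (rule ccontr)
    assume no: "\<not> ?thesis"
    have "q s = m" if "s0 \<le> s" for s
      using that by (induction s rule: dec_induct) (use s0 no q(2) in auto)
    then show False using T[of s0 m] no by blast
  qed
  show ?thesis
  proof (induction m)
    case 0 show ?case by (rule step[OF q(1)])
  next
    case (Suc m)
    then obtain s where "q s = m" "T m s" by blast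
    then have "q (Suc s) = Suc m" using q(2)[of s] by simp
    then show ?case by (rule step)
  qed
qed

text \<open>
  A primitive recursive \<open>h\<close> with \<open>s \<le> b (h s)\<close> for all \<open>s\<close> would be bounded by \<open>fast j\<close> for all large
  \<open>j\<close>, so failures at arbitrarily high levels rule it out.
\<close>

lemma not_topI:
  assumes b: "counting_fun b" and diag: "\<And>k. \<exists>j\<ge>k. \<exists>x. b (Suc (fast j x)) < x"
  shows "\<not> speed_le (\<lambda>s. s) b"
proof
  assume "speed_le (\<lambda>s. s) b"
  then obtain h where h: "primrec_unary h" "\<And>s. s \<le> b (h s)" unfolding speed_le_def by blast
  obtain k where k: "\<And>j x. k \<le> j \<Longrightarrow> h x \<le> fast j x" using primrec_unary_majorized[OF h(1)] by blast
  obtain j x where jx: "k \<le> j" "b (Suc (fast j x)) < x" using diag by blast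
  then show False
    using h(2)[of x] counting_fun_le[OF b, of "h x" "Suc (fast j x)"] k[OF jx(1), of x] by simp
qed

lemma primrec_stage: "primrec_unary (\<lambda>x. Suc (fast j x))"
  unfolding primrec_unary_iff by (intro pr_Suc pr_app1[OF primrec_fast] pr_nth) auto

text \<open>
  Here the number of completed phases is the counting function itself.  It keeps the value \<open>m\<close> until a
  stage \<open>Suc (fast m x)\<close> with \<open>x > m\<close> is reached, by which time it has fallen behind the \<open>m\<close>-th bound.
\<close>

lemma exists_not_top: obtains u where "counting_fun u" "\<not> speed_le (\<lambda>s. s) u"
proof -
  \<comment> \<open>Phase \<open>0\<close> ends at once, to give the required value \<open>1\<close> at stage \<open>1\<close>.\<close>
  define T where "T m s \<longleftrightarrow> m = 0 \<or> (\<exists>x<Suc s. s = Suc (fast m x) \<and> m < x)" for m s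
  define u where "u = rec_nat 0 (\<lambda>s r. r + of_bool (T r s))"
  have u: "u 0 = 0" "\<And>s. u (Suc s) = u s + of_bool (T (u s) s)"
    unfolding u_def by simp_all
  have prT: "prp 2 (\<lambda>xs. T (xs ! 0) (xs ! 1))"
    unfolding T_def by (intro pr_intros prp_bex prp_fast_graph) auto
  have "pr 1 (\<lambda>xs. u (xs ! 0))"
    unfolding u_def by (intro pr_rec pr_intros pr_app2[OF prT]) auto
  then have pu: "primrec_unary u" unfolding primrec_unary_iff .
  have "\<exists>s\<ge>s0. T m s" for m s0
  proof (intro exI[of _ "Suc (fast m (Suc m + s0))"] conjI)
    have *: "Suc m + s0 < fast m (Suc m + s0)" by (rule fast_greater)
    then show "s0 \<le> Suc (fast m (Suc m + s0))" by linarith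
    show "T m (Suc (fast m (Suc m + s0)))"
      unfolding T_def using * by (intro disjI2 exI[of _ "Suc m + s0"]) auto
  qed
  then have ph: "\<exists>s. u s = m \<and> T m s" for m
    using phases[of u T m, OF u] by simp
  have counting_fun: "counting_fun u"
    unfolding counting_fun_def
  proof (intro conjI allI)
    show "u 1 = 1" using u(1) u(2)[of 0] by (simp add: T_def)
    show "\<exists>s. n \<le> u s" for n using ph[of n] by blast
  qed (simp_all add: pu u)
  moreover have "\<not> speed_le (\<lambda>s. s) u"
  proof (rule not_topI[OF counting_fun])
    fix k
    obtain s where "u s = Suc k" "T (Suc k) s" using ph by blast
    then obtain x where "u (Suc (fast (Suc k) x)) < x" unfolding T_def by (metis nat.distinct(1))
    then show "\<exists>j\<ge>k. \<exists>x. u (Suc (fast j x)) < x" by (intro exI[of _ "Suc k"]) auto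
  qed
  ultimately show ?thesis by (rule that)
qed

text \<open>
  Changing between \<open>y\<close> and \<open>e\<close> causes no jump if it happens where they agree.
\<close>

lemma alternating_counting_fun:
  assumes y: "counting_fun y" and e: "counting_fun e" and le: "\<And>s. y s \<le> e s"
    and A: "primrec_set A" "\<And>s. (s \<in> A) \<noteq> (Suc s \<in> A) \<Longrightarrow> y s = e s"
  shows "counting_fun (\<lambda>s. if s \<in> A then y s else e s)"
proof -
  have pr: "primrec_unary y" "primrec_unary e" using y e unfolding counting_fun_def by auto
  have "primrec_unary (\<lambda>s. if s \<in> A then y s else e s)"
    unfolding primrec_unary_iff
    by (intro pr_if prp_mem[OF A(1)] pr_app1[OF pr(1)] pr_app1[OF pr(2)] pr_nth) auto
  moreover have "(if s \<in> A then y s else e s) \<le> (if Suc s \<in> A then y (Suc s) else e (Suc s)) \<and>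
      (if Suc s \<in> A then y (Suc s) else e (Suc s)) \<le> Suc (if s \<in> A then y s else e s)" for s
  proof -
    have "y s \<le> y (Suc s)" "y (Suc s) \<le> Suc (y s)" "e s \<le> e (Suc s)" "e (Suc s) \<le> Suc (e s)"
      using y e unfolding counting_fun_def by auto
    then show ?thesis using A(2)[of s] by auto
  qed
  moreover have "\<exists>s. n \<le> (if s \<in> A then y s else e s)" for n
  proof -
    obtain s where "n \<le> y s" using y unfolding counting_fun_def by blast
    then show ?thesis using le[of s] by (intro exI[of _ s]) auto
  qed
  ultimately show ?thesis using y e unfolding counting_fun_def by auto
qed

text \<open>
  Each phase in which one of \<open>b, c\<close> follows \<open>y\<close> has two parts.  In the first, counted by even values of
  \<open>q\<close>, a stage is awaited that refutes the current bound; in the second, counted by odd values, an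
  agreement of \<open>y\<close> and \<open>e\<close> is awaited.  The first part ends because \<open>y\<close> is not greatest.
\<close>

lemma split_exists:
  assumes y: "counting_fun y" and e: "counting_fun e" and top: "speed_le (\<lambda>s. s) e"
    and ntop: "\<not> speed_le (\<lambda>s. s) y"
    and meet: "\<And>s. \<exists>t\<ge>s. y t = e t"
  obtains b c where "counting_fun b" "counting_fun c" "\<not> speed_le (\<lambda>s. s) b" "\<not> speed_le (\<lambda>s. s) c"
    "\<And>s. min (b s) (c s) = y s" "\<And>s. e s \<le> max (b s) (c s)"
proof -
  \<comment> \<open>Replacing \<open>e\<close> by \<open>max y e\<close> keeps the agreements and makes \<open>y\<close> the smaller function throughout.\<close>
  define e' where "e' s = max (y s) (e s)" for s
  have e': "counting_fun e'" "\<And>s. y s \<le> e' s"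
    unfolding e'_def using counting_fun_max[OF y e] by auto
  have py: "primrec_unary y" and pe: "primrec_unary e'" using y e'(1) unfolding counting_fun_def by auto
  define T where "T q s \<longleftrightarrow> (even q \<and> (\<exists>x<Suc s. s = Suc (fast (q div 2) x) \<and> y s < x)) \<or>
      (odd q \<and> y s = e' s)" for q s
  define q where "q = rec_nat 0 (\<lambda>s r. r + of_bool (T r s))"
  have q: "q 0 = 0" "\<And>s. q (Suc s) = q s + of_bool (T (q s) s)"
    unfolding q_def by simp_all
  have prT: "prp 2 (\<lambda>xs. T (xs ! 0) (xs ! 1))"
    unfolding T_def
    by (intro pr_intros prp_bex prp_fast_graph prp_even pr_div2 pr_app1[OF py] pr_app1[OF pe]) auto
  have prq: "primrec_unary q"
    unfolding q_def primrec_unary_iff by (intro pr_rec pr_intros pr_app2[OF prT]) auto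
  have "\<exists>s\<ge>s0. T m s" for m s0
  proof (cases "even m")
    case True
    let ?h = "\<lambda>x. Suc (fast (m div 2) x)"
    have "\<exists>x\<ge>s0. y (?h x) < x"
    proof (rule ccontr)
      assume "\<not> ?thesis"
      then show False
        using ntop top_if_eventually[OF y primrec_stage[of "m div 2"], of s0] by (meson not_less)
    qed
    then obtain x where x: "s0 \<le> x" "y (?h x) < x" by blast
    have "x < ?h x" using fast_greater[of x "m div 2"] by simp
    then show ?thesis
      using True x unfolding T_def by (intro exI[of _ "?h x"] conjI disjI1 exI[of _ x]) auto
  next
    case False
    then show ?thesis using meet[of s0] unfolding T_def e'_def by auto
  qed
  then have ph: "\<exists>s. q s = m \<and> T m s" for m
    using phases[of q T m, OF q] by simp
  \<comment> \<open>The stages at which \<open>b\<close> follows \<open>y\<close>; membership changes only when \<open>q\<close> leaves an odd value.\<close>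
  define A where "A = {s. even (q s div 2)}"
  have prA: "primrec_set A" "primrec_set (- A)"
    unfolding primrec_set_iff A_def mem_Collect_eq Compl_iff
    by (intro prp_even prp_not pr_div2 pr_app1[OF prq] pr_nth; simp)+
  have switch: "y s = e' s" if "(s \<in> A) \<noteq> (Suc s \<in> A)" for s
  proof -
    have "T (q s) s" using that q(2)[of s] by (cases "T (q s) s") (auto simp: A_def)
    moreover have "odd (q s)"
      using that q(2)[of s] by (cases "T (q s) s") (auto simp: A_def)
    ultimately show ?thesis unfolding T_def by blast
  qed
  define b where "b s = (if s \<in> A then y s else e' s)" for s
  define c where "c s = (if s \<in> - A then y s else e' s)" for s
  have counting_fun: "counting_fun b" "counting_fun c"
    unfolding b_def c_def using prA switch by (intro alternating_counting_fun y e'; auto)+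
  have ev: "\<exists>s x. q s = 2 * j \<and> s = Suc (fast j x) \<and> y s < x" for j
    using ph[of "2 * j"] unfolding T_def by auto
  show ?thesis
  proof (rule that[OF counting_fun])
    show "\<not> speed_le (\<lambda>s. s) b"
    proof (rule not_topI[OF counting_fun(1)])
      fix k
      obtain s x where "q s = 2 * (2 * k)" "s = Suc (fast (2 * k) x)" "y s < x"
        using ev[of "2 * k"] by blast
      then show "\<exists>j\<ge>k. \<exists>x. b (Suc (fast j x)) < x"
        by (intro exI[of _ "2 * k"] conjI exI[of _ x]) (auto simp: b_def A_def)
    qed
    show "\<not> speed_le (\<lambda>s. s) c"
    proof (rule not_topI[OF counting_fun(2)])
      fix k
      obtain s x where "q s = 2 * Suc (2 * k)" "s = Suc (fast (Suc (2 * k)) x)" "y s < x"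
        using ev[of "Suc (2 * k)"] by blast
      then show "\<exists>j\<ge>k. \<exists>x. c (Suc (fast j x)) < x"
        by (intro exI[of _ "Suc (2 * k)"] conjI exI[of _ x]) (auto simp: c_def A_def simp del: fast.simps)
    qed
    show "min (b s) (c s) = y s" for s
      using e'(2)[of s] by (auto simp: b_def c_def)
    show "e s \<le> max (b s) (c s)" for s
      by (auto simp: b_def c_def e'_def)
  qed
qed

section \<open>The two degrees told apart in the order\<close>

definition is_top :: "nat rel set \<Rightarrow> bool" where
  "is_top d \<longleftrightarrow> (\<forall>e\<in>Peq. deg_le e d)"

text \<open>
  Meets and joins are described by their bounds, so that invariance under isomorphisms is immediate.
\<close>

definition splits :: "nat rel set \<Rightarrow> bool" where
  "splits a \<longleftrightarrow> (\<exists>b\<in>Peq. \<exists>c\<in>Peq. deg_le a b \<and> deg_le a c \<and> \<not> is_top b \<and> \<not> is_top c \<and>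
     (\<forall>d\<in>Peq. deg_le d b \<and> deg_le d c \<longrightarrow> deg_le d a) \<and>
     (\<forall>d\<in>Peq. deg_le b d \<and> deg_le c d \<longrightarrow> is_top d))"

lemma splitsI:
  assumes "b \<in> Peq" "c \<in> Peq" "deg_le a b" "deg_le a c" "\<not> is_top b" "\<not> is_top c"
    and "\<And>d. d \<in> Peq \<Longrightarrow> deg_le d b \<Longrightarrow> deg_le d c \<Longrightarrow> deg_le d a"
    and "\<And>d. d \<in> Peq \<Longrightarrow> deg_le b d \<Longrightarrow> deg_le c d \<Longrightarrow> is_top d"
  shows "splits a"
  unfolding splits_def using assms by blast

lemma Peq_iff: "d \<in> Peq \<longleftrightarrow> (\<exists>D. punctual_equiv D \<and> d = pr_deg D)"
  unfolding Peq_def pr_deg_def quotient_def by auto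

lemma pr_deg_in_Peq: "punctual_equiv R \<Longrightarrow> pr_deg R \<in> Peq"
  using Peq_iff by blast

lemma pr_deg_eqI:
  "punctual_equiv R \<Longrightarrow> punctual_equiv S \<Longrightarrow> R \<le>pr S \<Longrightarrow> S \<le>pr R \<Longrightarrow> pr_deg R = pr_deg S"
  unfolding pr_deg_def by (rule equiv_class_eq[OF equiv_pr_eq_rel]) (auto simp: pr_eq_rel_def pr_eq_def)

lemma deg_le_iff_speed_le:
  "punctual_equiv R \<Longrightarrow> punctual_equiv S \<Longrightarrow>
    deg_le (pr_deg R) (pr_deg S) \<longleftrightarrow> speed_le (num_classes R) (num_classes S)"
  by (simp add: deg_le_pr_deg pr_le_iff_speed_le)

lemma Peq_cases:
  assumes "d \<in> Peq" obtains D where "punctual_equiv D" "d = pr_deg D" "counting_fun (num_classes D)"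
  using assms counting_fun_num_classes unfolding Peq_iff by blast

lemma is_top_iff:
  assumes R: "punctual_equiv R" shows "is_top (pr_deg R) \<longleftrightarrow> speed_le (\<lambda>s. s) (num_classes R)"
proof
  assume t: "is_top (pr_deg R)"
  obtain I where "punctual_equiv I" "num_classes I = (\<lambda>s. s)"
    using counting_fun_realised[OF counting_fun_id] by blast
  then show "speed_le (\<lambda>s. s) (num_classes R)"
    using t R deg_le_iff_speed_le pr_deg_in_Peq unfolding is_top_def by metis
next
  assume c: "speed_le (\<lambda>s. s) (num_classes R)"
  show "is_top (pr_deg R)" unfolding is_top_def
  proof
    fix e assume "e \<in> Peq"
    then obtain E where "punctual_equiv E" "e = pr_deg E" "counting_fun (num_classes E)" by (rule Peq_cases)
    then show "deg_le e (pr_deg R)"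
      using R deg_le_iff_speed_le speed_le_trans[OF speed_le_pointwise c] counting_fun_le_id by blast
  qed
qed

lemma slow_not_splits:
  assumes X: "primrec_set X" "infinite (- X)" "slow X"
  shows "\<not> is_top (pr_deg (set_rel X))" "\<not> splits (pr_deg (set_rel X))"
proof -
  let ?R = "set_rel X"
  have R: "punctual_equiv ?R" using X by (intro punctual_equiv_set_rel)
  have dom: "\<exists>s0. \<forall>s\<ge>s0. num_classes ?R (h s) < s" if "primrec_unary h" for h
    using slow_dominates[OF X(2,3) that] .
  show "\<not> is_top (pr_deg ?R)"
    unfolding is_top_iff[OF R] speed_le_def using dom by (meson leD order_refl)
  show "\<not> splits (pr_deg ?R)"
  proof
    assume "splits (pr_deg ?R)"
    then obtain b c where bc: "b \<in> Peq" "c \<in> Peq" "\<not> is_top b" "\<not> is_top c"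
        "\<And>d. d \<in> Peq \<Longrightarrow> deg_le d b \<Longrightarrow> deg_le d c \<Longrightarrow> deg_le d (pr_deg ?R)"
        "\<And>d. d \<in> Peq \<Longrightarrow> deg_le b d \<Longrightarrow> deg_le c d \<Longrightarrow> is_top d"
      unfolding splits_def by blast
    obtain B where B: "punctual_equiv B" "b = pr_deg B" "counting_fun (num_classes B)" using bc(1) by (rule Peq_cases)
    obtain C where C: "punctual_equiv C" "c = pr_deg C" "counting_fun (num_classes C)" using bc(2) by (rule Peq_cases)
    obtain J where J: "punctual_equiv J" "num_classes J = (\<lambda>s. max (num_classes B s) (num_classes C s))"
      using counting_fun_realised[OF counting_fun_max[OF B(3) C(3)]] .
    obtain M where M: "punctual_equiv M" "num_classes M = (\<lambda>s. min (num_classes B s) (num_classes C s))"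
      using counting_fun_realised[OF counting_fun_min[OF B(3) C(3)]] .
    have "is_top (pr_deg J)"
      using B(1,2) C(1,2) J by (intro bc(6) pr_deg_in_Peq) (auto simp: deg_le_iff_speed_le intro: speed_le_pointwise)
    then have join: "speed_le (\<lambda>s. s) (\<lambda>s. max (num_classes B s) (num_classes C s))"
      by (simp add: is_top_iff J)
    have "deg_le (pr_deg M) (pr_deg ?R)"
      using B(1,2) C(1,2) M by (intro bc(5) pr_deg_in_Peq) (auto simp: deg_le_iff_speed_le intro: speed_le_pointwise)
    then have meet: "speed_le (\<lambda>s. min (num_classes B s) (num_classes C s)) (num_classes ?R)"
      by (simp add: deg_le_iff_speed_le M R)
    show False
      using no_split_if_dominated[OF B(3) C(3) dom meet join] bc(3,4) B C by (simp add: is_top_iff)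
  qed
qed

lemma speed_le_id_even: "speed_le (\<lambda>s. s) (num_classes (set_rel {n. even n}))"
proof -
  have "s \<le> num_classes (set_rel {n. even n}) (2 * s)" for s
    by (induction s) (auto simp: num_classes_Suc leaders_set_rel)
  moreover have "primrec_unary (\<lambda>s. 2 * s)"
    unfolding primrec_unary_iff by (intro pr_intros) auto
  ultimately show ?thesis unfolding speed_le_def by (intro exI[of _ "\<lambda>s. 2 * s"]) auto
qed

lemma punctual_even: "punctual_equiv (set_rel {n. even n})"
proof (rule punctual_equiv_set_rel)
  show "primrec_set {n. even n}"
    unfolding primrec_set_iff mem_Collect_eq by (intro prp_even pr_nth) auto
  have "range (\<lambda>n. Suc (2 * n)) \<subseteq> - {n. even n}" by auto
  moreover have "infinite (range (\<lambda>n. Suc (2 * n)))"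
    by (intro range_inj_infinite injI) auto
  ultimately show "infinite (- {n :: nat. even n})" by (rule infinite_super)
qed

text \<open>
  The class \<open>U\<close>, once met, adds one to the number of zeros; this offset is the same for all \<open>U\<close>, so
  equal numbers of zeros give equal numbers of classes.
\<close>

lemma num_classes_count_zeros: "i \<in> U \<Longrightarrow> i \<le> t \<Longrightarrow> num_classes (set_rel U) (Suc t) = Suc (count_zeros U t)"
  by (auto simp: num_classes_set_rel count_zeros_def less_Suc_eq_le)

lemma black_lozenge_splits:
  assumes Y: "primrec_set Y" "infinite (- Y)" "black_lozenge Y {n. even n}"
  shows "is_top (pr_deg (set_rel Y)) \<or> splits (pr_deg (set_rel Y))"
proof -
  obtain V E where V: "primrec_set V" "infinite V" "infinite (- V)" "set_rel V \<equiv>pr set_rel Y"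
    and E: "primrec_set E" "infinite E" "infinite (- E)" "set_rel E \<equiv>pr set_rel {n. even n}"
    and eq: "\<And>s. \<exists>t\<ge>s. count_zeros V t = count_zeros E t"
    using Y(3) unfolding black_lozenge_def by blast
  let ?y = "num_classes (set_rel V)" and ?e = "num_classes (set_rel E)"
  have pV: "punctual_equiv (set_rel V)" and pE: "punctual_equiv (set_rel E)"
    and pY: "punctual_equiv (set_rel Y)"
    using V E Y by (auto intro: punctual_equiv_set_rel)
  have deg: "pr_deg (set_rel Y) = pr_deg (set_rel V)"
    using V(4) pV pY unfolding pr_eq_def by (intro pr_deg_eqI) auto
  have top: "speed_le (\<lambda>s. s) ?e"
    using E(4) pr_le_iff_speed_le[OF punctual_even pE] speed_le_trans[OF speed_le_id_even]
    unfolding pr_eq_def by blast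
  have meet: "\<exists>t\<ge>s. ?y t = ?e t" for s
  proof -
    obtain v w where "v \<in> V" "w \<in> E" using V(2) E(2) by fastforce
    moreover obtain t where "s + v + w \<le> t" "count_zeros V t = count_zeros E t" using eq by blast
    ultimately show ?thesis
      using num_classes_count_zeros[of v V t] num_classes_count_zeros[of w E t] by (intro exI[of _ "Suc t"]) auto
  qed
  show ?thesis
  proof (cases "speed_le (\<lambda>s. s) ?y")
    case True
    then show ?thesis by (simp add: deg is_top_iff pV)
  next
    case False
    obtain b c where bc: "counting_fun b" "counting_fun c" "\<not> speed_le (\<lambda>s. s) b" "\<not> speed_le (\<lambda>s. s) c"
        "\<And>s. min (b s) (c s) = ?y s" "\<And>s. ?e s \<le> max (b s) (c s)"
      using split_exists[OF counting_fun_num_classes[OF pV] counting_fun_num_classes[OF pE] top False meet] by metis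
    obtain B where B: "punctual_equiv B" "num_classes B = b" using counting_fun_realised[OF bc(1)] .
    obtain C where C: "punctual_equiv C" "num_classes C = c" using counting_fun_realised[OF bc(2)] .
    have "splits (pr_deg (set_rel V))"
    proof (rule splitsI)
      show "pr_deg B \<in> Peq" "pr_deg C \<in> Peq"
        using B C by (simp_all add: pr_deg_in_Peq)
      have "?y s \<le> b s" "?y s \<le> c s" for s
        using bc(5)[of s] by linarith+
      then show "deg_le (pr_deg (set_rel V)) (pr_deg B)" "deg_le (pr_deg (set_rel V)) (pr_deg C)"
        using B C pV by (simp_all add: deg_le_iff_speed_le speed_le_pointwise)
      show "\<not> is_top (pr_deg B)" "\<not> is_top (pr_deg C)"
        using B C bc(3,4) by (simp_all add: is_top_iff)
      fix d assume "d \<in> Peq"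
      then obtain D where D: "punctual_equiv D" "d = pr_deg D" "counting_fun (num_classes D)" by (rule Peq_cases)
      show "deg_le d (pr_deg (set_rel V))" if "deg_le d (pr_deg B)" "deg_le d (pr_deg C)"
        using speed_le_min[OF bc(1,2), of "num_classes D"] that B C D pV by (simp add: deg_le_iff_speed_le bc(5))
      show "is_top d" if "deg_le (pr_deg B) d" "deg_le (pr_deg C) d"
      proof -
        have "speed_le (\<lambda>s. max (b s) (c s)) (num_classes D)"
          using that B C D by (intro speed_le_max) (simp_all add: deg_le_iff_speed_le)
        then have "speed_le (\<lambda>s. s) (num_classes D)"
          using speed_le_trans[OF top speed_le_trans[OF speed_le_pointwise[OF bc(6)]]] by blast
        then show ?thesis using D by (simp add: is_top_iff)
      qed
    qed
    then show ?thesis by (simp add: deg)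
  qed
qed

lemma deg_iso_is_top:
  assumes iso: "deg_iso Peq Peq \<phi>" and d: "d \<in> Peq" shows "is_top (\<phi> d) \<longleftrightarrow> is_top d"
proof -
  have im: "\<phi> ` Peq = Peq" and le: "\<And>a b. a \<in> Peq \<Longrightarrow> b \<in> Peq \<Longrightarrow> deg_le (\<phi> a) (\<phi> b) \<longleftrightarrow> deg_le a b"
    using iso unfolding deg_iso_def bij_betw_def by auto
  have "is_top (\<phi> d) \<longleftrightarrow> (\<forall>e\<in>\<phi> ` Peq. deg_le e (\<phi> d))"
    unfolding is_top_def im ..
  also have "\<dots> \<longleftrightarrow> is_top d" using le d unfolding is_top_def by simp
  finally show ?thesis .
qed

lemma deg_iso_splits:
  assumes iso: "deg_iso Peq Peq \<phi>" and a: "a \<in> Peq" and s: "splits a" shows "splits (\<phi> a)"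
proof -
  have im: "\<phi> ` Peq = Peq" and le: "\<And>a b. a \<in> Peq \<Longrightarrow> b \<in> Peq \<Longrightarrow> deg_le (\<phi> a) (\<phi> b) \<longleftrightarrow> deg_le a b"
    using iso unfolding deg_iso_def bij_betw_def by auto
  obtain b c where bc: "b \<in> Peq" "c \<in> Peq" "deg_le a b" "deg_le a c" "\<not> is_top b" "\<not> is_top c"
      "\<forall>d\<in>Peq. deg_le d b \<and> deg_le d c \<longrightarrow> deg_le d a"
      "\<forall>d\<in>Peq. deg_le b d \<and> deg_le c d \<longrightarrow> is_top d"
    using s unfolding splits_def by blast
  have "\<forall>d\<in>\<phi> ` Peq. deg_le d (\<phi> b) \<and> deg_le d (\<phi> c) \<longrightarrow> deg_le d (\<phi> a)"
       "\<forall>d\<in>\<phi> ` Peq. deg_le (\<phi> b) d \<and> deg_le (\<phi> c) d \<longrightarrow> is_top d"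
    using bc a le deg_iso_is_top[OF iso] by auto
  moreover have "\<phi> b \<in> Peq" "\<phi> c \<in> Peq" using bc(1,2) im by auto
  ultimately show ?thesis
    unfolding splits_def im using bc le a deg_iso_is_top[OF iso] by (intro bexI[of _ "\<phi> b"] bexI[of _ "\<phi> c"]) auto
qed

lemma upper_cones_not_isomorphic:
  "\<exists>a\<in>Peq. \<exists>b\<in>Peq. \<not> (\<exists>\<phi>. deg_iso (upper_cone a) (upper_cone b) \<phi>)"
proof -
  obtain I where I: "punctual_equiv I" "num_classes I = (\<lambda>s. s)"
    using counting_fun_realised[OF counting_fun_id] .
  obtain u where u: "counting_fun u" "\<not> speed_le (\<lambda>s. s) u" by (rule exists_not_top)
  obtain N where N: "punctual_equiv N" "num_classes N = u"
    using counting_fun_realised[OF u(1)] .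
  let ?a = "pr_deg I" and ?b = "pr_deg N"
  have top: "is_top ?a" and ntop: "\<not> is_top ?b"
    using I N u(2) by (auto simp: is_top_iff intro: speed_le_pointwise)
  have "upper_cone ?a \<subseteq> {?a}"
  proof
    fix d assume "d \<in> upper_cone ?a"
    then have d: "d \<in> Peq" "deg_le ?a d" unfolding upper_cone_def by auto
    obtain D where D: "punctual_equiv D" "d = pr_deg D" "counting_fun (num_classes D)" using d(1) by (rule Peq_cases)
    have "deg_le d ?a" using top d(1) unfolding is_top_def by blast
    then show "d \<in> {?a}"
      using d(2) D I pr_deg_eqI[OF D(1) I(1)] by (simp add: deg_le_pr_deg)
  qed
  moreover have "?a \<in> upper_cone ?b" "?b \<in> upper_cone ?b"
    using top I N unfolding upper_cone_def is_top_def by (auto simp: pr_deg_in_Peq deg_le_pr_deg pr_le_refl)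
  moreover have "?a \<noteq> ?b" using top ntop by metis
  ultimately have "\<not> bij_betw \<phi> (upper_cone ?a) (upper_cone ?b)" for \<phi>
    unfolding bij_betw_def by (metis (no_types) image_iff singletonD subsetD)
  then show ?thesis
    unfolding deg_iso_def using I N pr_deg_in_Peq by blast
qed

theorem mainTheorem8:
  shows "(\<forall>X Y :: nat set.
            primrec_set X \<and> infinite (- X) \<and> slow X \<and>
            primrec_set Y \<and> infinite (- Y) \<and> black_lozenge Y {n. even n} \<longrightarrow>
            \<not> (\<exists>\<phi>. deg_iso Peq Peq \<phi> \<and> \<phi> (pr_deg (set_rel Y)) = pr_deg (set_rel X))) \<and>
         (\<exists>a\<in>Peq. \<exists>b\<in>Peq. \<not> (\<exists>\<phi>. deg_iso (upper_cone a) (upper_cone b) \<phi>))"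
proof (intro conjI allI impI notI)
  fix X Y :: "nat set"
  assume a: "primrec_set X \<and> infinite (- X) \<and> slow X \<and>
            primrec_set Y \<and> infinite (- Y) \<and> black_lozenge Y {n. even n}"
  assume "\<exists>\<phi>. deg_iso Peq Peq \<phi> \<and> \<phi> (pr_deg (set_rel Y)) = pr_deg (set_rel X)"
  then obtain \<phi> where \<phi>: "deg_iso Peq Peq \<phi>" "\<phi> (pr_deg (set_rel Y)) = pr_deg (set_rel X)" by blast
  have Y: "pr_deg (set_rel Y) \<in> Peq"
    using a by (intro pr_deg_in_Peq punctual_equiv_set_rel) auto
  have "is_top (pr_deg (set_rel X)) \<or> splits (pr_deg (set_rel X))"
    using black_lozenge_splits[of Y] a deg_iso_is_top[OF \<phi>(1) Y] deg_iso_splits[OF \<phi>(1) Y] \<phi>(2) by auto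
  then show False using slow_not_splits[of X] a by blast
qed (rule upper_cones_not_isomorphic)

end
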